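(* Let $n$ be a positive integer, $\alpha>n/2$, and let $X=\{\mathbf{x}_j\in\mathbb{R}^n: j\in\mathbb{N}\}$ be a set of distinct points with $\delta(X)=\inf_{j\neq k}|\mathbf{x}_j-\mathbf{x}_k|>0$. (i) If $n\ge 2$, then $\{G_\alpha(\mathbf{x}-\mathbf{x}_j)\}_{j\in\mathbb{N}}$ is a Riesz sequence in the Sobolev space $H^\alpha(\mathbb{R}^n)$. (ii) If $n=1$ and $\delta(X)> \frac{4\,\Gamma(\alpha)\Gamma(1/2)}{\Gamma(\alpha-1/2)}$, then $\{G_\alpha(x-x_j)\}_{j\in\mathbb{N}}$ is a Riesz sequence in $H^\alpha(\mathbb{R})$.
   Context: For $\gamma>0$, $G_\gamma(\mathbf{x})=G_\gamma(|\mathbf{x}|)$ with $G_\gamma(z)=\frac{1}{2^{\gamma-1+\frac n2}\pi^{\frac n2}\Gamma(\gamma)}K_{\gamma-\frac n2}(z)z^{\gamma-\frac n2}$ for $z>0$ (value at $0$ by continuity when $\gamma>n/2$), $K_\nu$ being the modified Bessel function of the second kind. With $\widehat u(\xi)=\int_{\mathbb{R}^n}e^{-i\xi\cdot\mathbf{x}}u(\mathbf{x})d\mathbf{x}$, $H^\alpha(\mathbb{R}^n)=\{u\in L^2(\mathbb{R}^n):\int(1+|\xi|^2)^\alpha|\widehat u(\xi)|^2d\xi<\infty\}$ with inner product $(u,v)_{H^\alpha}=(2\pi)^{-n}\int\widehat u(\xi)\overline{\widehat v(\xi)}(1+|\xi|^2)^\alpha d\xi$. A system $\{f_j\}$ in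 a Hilbert space $H$ is a Riesz sequence if there are $0<A\le B<\infty$ with $A\sum_j|c_j|^2\le\|\sum_jc_jf_j\|_H^2\le B\sum_j|c_j|^2$ for all finitely supported complex sequences $(c_j)$ (equivalently, its Gramian matrix defines a bounded invertible operator on $\ell^2(\mathbb{N})$). *)

theory Defs
  imports "HOL-Analysis.Analysis"
begin

text \<open>Modified Bessel function of the second kind, via the standard integral
  representation K_nu(z) = int_0^infty exp(-z cosh t) cosh(nu t) dt, for z > 0.\<close>
definition besselK :: "real \<Rightarrow> real \<Rightarrow> real" where
  "besselK \<nu> z = (LINT t:{0..}|lborel. exp (- z * cosh t) * cosh (\<nu> * t))"

text \<open>Radial profile of the Bessel potential G_gamma in dimension n; the value at 0
  is defined by continuity (the right limit), which exists when gamma > n/2.\<close>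
definition bessel_profile :: "nat \<Rightarrow> real \<Rightarrow> real \<Rightarrow> real" where
  "bessel_profile n \<gamma> z =
     1 / (2 powr (\<gamma> - 1 + real n / 2) * pi powr (real n / 2) * Gamma \<gamma>)
       * besselK (\<gamma> - real n / 2) z * z powr (\<gamma> - real n / 2)"

definition bessel_G :: "nat \<Rightarrow> real \<Rightarrow> real \<Rightarrow> real" where
  "bessel_G n \<gamma> z =
     (if z > 0 then bessel_profile n \<gamma> z
      else Lim (at_right 0) (bessel_profile n \<gamma>))"

definition besselG :: "real \<Rightarrow> real^'n \<Rightarrow> real" where
  "besselG \<gamma> x = bessel_G CARD('n) \<gamma> (norm x)"

definition fourier_L1 :: "(real^'n \<Rightarrow> complex) \<Rightarrow> real^'n \<Rightarrow> complex" where
  "fourier_L1 u \<xi> = (LINT x|lborel. cis (- (\<xi> \<bullet> x)) * u x)"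

definition square_integrable :: "(real^'n \<Rightarrow> complex) \<Rightarrow> bool" where
  "square_integrable u \<longleftrightarrow> u \<in> borel_measurable lborel \<and>
      integrable lborel (\<lambda>x. (cmod (u x))\<^sup>2)"

definition is_fourier_L2 :: "(real^'n \<Rightarrow> complex) \<Rightarrow> (real^'n \<Rightarrow> complex) \<Rightarrow> bool" where
  "is_fourier_L2 u v \<longleftrightarrow> square_integrable v \<and>
     ((\<lambda>R. LINT \<xi>|lborel.
         (cmod (fourier_L1 (\<lambda>x. indicator (cball 0 R) x * u x) \<xi> - v \<xi>))\<^sup>2)
       \<longlongrightarrow> 0) at_top"

definition fourier_L2 :: "(real^'n \<Rightarrow> complex) \<Rightarrow> real^'n \<Rightarrow> complex" where
  "fourier_L2 u = (SOME v. is_fourier_L2 u v)"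

definition sobolev :: "real \<Rightarrow> (real^'n \<Rightarrow> complex) set" where
  "sobolev \<alpha> = {u. square_integrable u \<and>
      (\<exists>v. is_fourier_L2 u v \<and>
           integrable lborel (\<lambda>\<xi>. (1 + (norm \<xi>)\<^sup>2) powr \<alpha> * (cmod (v \<xi>))\<^sup>2))}"

definition sobolev_norm2 :: "real \<Rightarrow> (real^'n \<Rightarrow> complex) \<Rightarrow> real" where
  "sobolev_norm2 \<alpha> u = (2 * pi) powr (- real CARD('n)) *
      (LINT \<xi>|lborel. (1 + (norm \<xi>)\<^sup>2) powr \<alpha> * (cmod (fourier_L2 u \<xi>))\<^sup>2)"

definition riesz_sequence_sobolev :: "real \<Rightarrow> (nat \<Rightarrow> real^'n \<Rightarrow> complex) \<Rightarrow> bool" where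
  "riesz_sequence_sobolev \<alpha> f \<longleftrightarrow> (\<forall>j. f j \<in> sobolev \<alpha>) \<and>
     (\<exists>A B. 0 < A \<and> A \<le> B \<and>
        (\<forall>(S::nat set) (c::nat \<Rightarrow> complex). finite S \<longrightarrow>
            A * (\<Sum>j\<in>S. (cmod (c j))\<^sup>2) \<le> sobolev_norm2 \<alpha> (\<lambda>x. \<Sum>j\<in>S. c j * f j x) \<and>
            sobolev_norm2 \<alpha> (\<lambda>x. \<Sum>j\<in>S. c j * f j x) \<le> B * (\<Sum>j\<in>S. (cmod (c j))\<^sup>2)))"

definition separation :: "(nat \<Rightarrow> real^'n) \<Rightarrow> real" where
  "separation X = Inf {dist (X j) (X k) | j k. j \<noteq> k}"

end

theory Submission
  imports Defs "HOL-Probability.Characteristic_Functions"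
begin

text \<open>
  The Bessel potential is a mixture of Gaussians, so its Fourier transform is \<open>(1 + |\<xi>|\<^sup>2)\<^sup>-\<^sup>\<alpha>\<close> and the
  squared Sobolev norm of \<open>\<Sum> c\<^sub>j G(x - x\<^sub>j)\<close> is the integral of \<open>|\<Sum> c\<^sub>j exp(-i \<xi> x\<^sub>j)|\<^sup>2 (1 + |\<xi>|\<^sup>2)\<^sup>-\<^sup>\<alpha>\<close>, up to a
  constant. Writing \<open>\<Gamma>(\<alpha>) (1 + |\<xi>|\<^sup>2)\<^sup>-\<^sup>\<alpha> = \<integral> t\<^sup>\<alpha>\<^sup>-\<^sup>1 exp(-t) exp(-t |\<xi>|\<^sup>2) dt\<close> turns this into an average over \<open>t > 0\<close> of
  the quadratic forms of the Gaussian Gram matrices with entries proportional to \<open>exp(-|x\<^sub>j - x\<^sub>k|\<^sup>2 / (4 t))\<close>.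
  Separation bounds their row sums by a multiple of \<open>1 + t\<^sup>n\<^sup>/\<^sup>2\<close>, which gives the upper Riesz bound by Schur's
  test. For small \<open>t\<close> the matrices are uniformly diagonally dominant and for the other \<open>t\<close> they are
  positive semidefinite, which gives the lower bound.
\<close>

subsection \<open>Gaussians\<close>

text \<open>The Gram matrix of the translates in the Sobolev space has entries G(x_j - x_k). When
  the points are close together it need not be diagonally dominant, so its row sums alone cannot
  give the lower Riesz bound. In the mixture, diagonal dominance is available at fine scales for
  every positive separation: a window of small \<open>t\<close> carries positive weight, and the
  nonnegative contribution of all other \<open>t\<close> can be discarded. The condition \<alpha> >
  n/2 enters through the weight: integrating out \<xi> produces (pi/t)^(n/2), which turns
  t^(\<alpha>-1) into t^(\<alpha>-n/2-1), and this is integrable at 0 exactly in that range. A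
  second obstacle is that the norm is defined through \<open>fourier_L2\<close>, an arbitrary choice
  among the L2 limits of truncated transforms. It has to be identified almost everywhere with
  \<open>fourier_L1\<close>. The finite combinations are integrable and square integrable, so the
  inequality half of Plancherel, obtained by Gaussian damping, is enough for this.\<close>

lemma has_bochner_integral_lborel_prod:
  fixes f :: "'a::euclidean_space \<Rightarrow> real \<Rightarrow> 'b::{real_normed_field,banach,second_countable_topology}"
  assumes "\<And>b. b \<in> Basis \<Longrightarrow> has_bochner_integral lborel (f b) (v b)"
  shows "has_bochner_integral lborel (\<lambda>x. \<Prod>b\<in>Basis. f b (x \<bullet> b)) (\<Prod>b\<in>Basis. v b)"
proof -
  interpret product_sigma_finite "\<lambda>_::'a. lborel :: real measure" ..
  have int: "integrable lborel (f b)" and val: "integral\<^sup>L lborel (f b) = v b" if "b \<in> Basis" for b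
    using assms[OF that] by (auto simp: has_bochner_integral_iff)
  have [measurable]: "f b \<in> borel_measurable borel" if "b \<in> Basis" for b
    using int[OF that] by auto
  have eq: "(\<Prod>b\<in>Basis. f b ((\<Sum>c\<in>Basis. x c *\<^sub>R c) \<bullet> b)) = (\<Prod>b\<in>Basis. f b (x b))" for x :: "'a \<Rightarrow> real"
    by (intro prod.cong) auto
  have "has_bochner_integral (\<Pi>\<^sub>M b\<in>(Basis::'a set). lborel) (\<lambda>x. \<Prod>b\<in>Basis. f b (x b)) (\<Prod>b\<in>Basis. v b)"
    using product_integrable_prod[OF finite_Basis int] product_integral_prod[OF finite_Basis int] val
    by (auto simp: has_bochner_integral_iff)
  then have "has_bochner_integral (\<Pi>\<^sub>M b\<in>(Basis::'a set). lborel)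
      (\<lambda>x. \<Prod>b\<in>Basis. f b ((\<Sum>c\<in>Basis. x c *\<^sub>R c) \<bullet> b)) (\<Prod>b\<in>Basis. v b)"
    by (simp only: eq)
  then show ?thesis
    by (subst lborel_eq, intro has_bochner_integral_distr) measurable
qed

text \<open>Up to scaling this is the characteristic function exp(-s^2/2) of the standard normal
  distribution.\<close>

lemma has_bochner_integral_gaussian_cis_real:
  fixes t z :: real
  assumes t: "t > 0"
  shows "has_bochner_integral lborel (\<lambda>x. cis (- (z * x)) * complex_of_real (exp (- t * x\<^sup>2)))
           (complex_of_real (sqrt (pi / t) * exp (- z\<^sup>2 / (4 * t))))"
proof -
  \<comment> \<open>With this \<open>c\<close> the normal density at \<open>c * x\<close> is a
    multiple of exp(-t x^2), and \<open>s\<close> below is the frequency with s c x = -z x.\<close>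
  define c where "c = sqrt (2 * t)"
  have c: "c > 0" "c\<^sup>2 = 2 * t" using t by (auto simp: c_def)
  define s where "s = - z / c"
  have int: "integrable lborel (\<lambda>x. std_normal_density x *\<^sub>R iexp (s * x))"
  proof (rule Bochner_Integration.integrable_bound)
    show "integrable lborel std_normal_density" by simp
    show "AE x in lborel. norm (std_normal_density x *\<^sub>R iexp (s * x)) \<le> norm (std_normal_density x)"
      by simp
  qed measurable
  have "complex_of_real (exp (- (s\<^sup>2) / 2)) = (LINT x|std_normal_distribution. iexp (s * x))"
    using char_std_normal_distribution by (simp add: char_def fun_eq_iff)
  also have "\<dots> = (LINT x|lborel. std_normal_density x *\<^sub>R iexp (s * x))"
    by (rule integral_density) auto
  finally have "has_bochner_integral lborel (\<lambda>x. std_normal_density x *\<^sub>R iexp (s * x)) (complex_of_real (exp (- (s\<^sup>2) / 2)))"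
    using int by (simp add: has_bochner_integral_iff)
  then have "has_bochner_integral lborel (\<lambda>x. std_normal_density (0 + c * x) *\<^sub>R iexp (s * (0 + c * x)))
     (complex_of_real (exp (- (s\<^sup>2) / 2)) /\<^sub>R \<bar>c\<bar>)"
    using c by (subst (asm) lborel_has_bochner_integral_real_affine_iff[where c=c and t=0]) auto
  then have "has_bochner_integral lborel (\<lambda>x. sqrt (2*pi) *\<^sub>R (std_normal_density (0 + c * x) *\<^sub>R iexp (s * (0 + c * x))))
     (sqrt (2*pi) *\<^sub>R (complex_of_real (exp (- (s\<^sup>2) / 2)) /\<^sub>R \<bar>c\<bar>))"
    by (rule has_bochner_integral_scaleR_right)
  also have "(\<lambda>x. sqrt (2*pi) *\<^sub>R (std_normal_density (0 + c * x) *\<^sub>R iexp (s * (0 + c * x))))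
      = (\<lambda>x. cis (- (z * x)) * complex_of_real (exp (- t * x\<^sup>2)))"
  proof
    fix x
    have "s * (c * x) = - (z * x)" using c by (simp add: s_def)
    moreover have "sqrt (2*pi) * std_normal_density (c * x) = exp (- t * x\<^sup>2)"
      using c by (simp add: std_normal_density_def power_mult_distrib)
    ultimately show "sqrt (2*pi) *\<^sub>R (std_normal_density (0 + c * x) *\<^sub>R iexp (s * (0 + c * x))) =
        cis (- (z * x)) * complex_of_real (exp (- t * x\<^sup>2))"
      by (simp only: scaleR_scaleR add_0 cis_conv_exp) (simp add: scaleR_conv_of_real)
  qed
  also have "sqrt (2*pi) *\<^sub>R (complex_of_real (exp (- (s\<^sup>2) / 2)) /\<^sub>R \<bar>c\<bar>)
      = complex_of_real (sqrt (pi / t) * exp (- z\<^sup>2 / (4 * t)))"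
  proof -
    have "s\<^sup>2 / 2 = z\<^sup>2 / (4 * t)" using c by (simp add: s_def power_divide)
    moreover have "sqrt (2*pi) / c = sqrt (pi / t)" using t by (simp add: c_def real_sqrt_divide real_sqrt_mult)
    ultimately show ?thesis
      using c by (simp add: scaleR_conv_of_real field_simps flip: of_real_mult of_real_divide of_real_inverse)
  qed
  finally show ?thesis .
qed

text \<open>Phase and Gaussian both factor over the coordinates, which reduces the transform to
  dimension one.\<close>

lemma gaussian_fourier:
  fixes z :: "'a::euclidean_space"
  assumes t: "t > 0"
  shows "has_bochner_integral lborel (\<lambda>x. cis (- (z \<bullet> x)) * complex_of_real (exp (- t * (norm x)\<^sup>2)))
           (complex_of_real ((pi / t) powr (DIM('a) / 2) * exp (- (norm z)\<^sup>2 / (4 * t))))"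
proof -
  have sq: "(norm x)\<^sup>2 = (\<Sum>b\<in>Basis. (x \<bullet> b)\<^sup>2)" for x :: 'a
    unfolding power2_norm_eq_inner by (subst euclidean_inner) (simp add: power2_eq_square)
  have cis_sum: "cis (\<Sum>b\<in>B. g b) = (\<Prod>b\<in>B. cis (g b))" if "finite B" for g and B :: "'a set"
    using that by (induction B rule: finite_induct) (auto simp: cis_mult[symmetric])
  have exp_sq: "exp (a * (norm x)\<^sup>2) = (\<Prod>b\<in>Basis. exp (a * (x \<bullet> b)\<^sup>2))" for a and x :: 'a
    by (simp add: sq sum_distrib_left exp_sum)
  have "has_bochner_integral lborel
      (\<lambda>x::'a. \<Prod>b\<in>Basis. cis (- ((z \<bullet> b) * (x \<bullet> b))) * complex_of_real (exp (- t * (x \<bullet> b)\<^sup>2)))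
      (\<Prod>b\<in>Basis. complex_of_real (sqrt (pi / t) * exp (- (z \<bullet> b)\<^sup>2 / (4 * t))))"
    by (intro has_bochner_integral_lborel_prod has_bochner_integral_gaussian_cis_real t)
  also have "(\<lambda>x::'a. \<Prod>b\<in>Basis. cis (- ((z \<bullet> b) * (x \<bullet> b))) * complex_of_real (exp (- t * (x \<bullet> b)\<^sup>2)))
      = (\<lambda>x. cis (- (z \<bullet> x)) * complex_of_real (exp (- t * (norm x)\<^sup>2)))"
  proof
    fix x :: 'a
    have "cis (- (z \<bullet> x)) = (\<Prod>b\<in>Basis. cis (- ((z \<bullet> b) * (x \<bullet> b))))"
      by (subst euclidean_inner) (simp only: cis_sum[OF finite_Basis] sum_negf[symmetric])
    then show "(\<Prod>b\<in>Basis. cis (- ((z \<bullet> b) * (x \<bullet> b))) * complex_of_real (exp (- t * (x \<bullet> b)\<^sup>2)))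
      = cis (- (z \<bullet> x)) * complex_of_real (exp (- t * (norm x)\<^sup>2))"
      by (simp only: exp_sq prod.distrib of_real_prod)
  qed
  also have "(\<Prod>b\<in>(Basis::'a set). complex_of_real (sqrt (pi / t) * exp (- (z \<bullet> b)\<^sup>2 / (4 * t))))
      = complex_of_real ((pi / t) powr (DIM('a) / 2) * exp (- (norm z)\<^sup>2 / (4 * t)))"
  proof -
    have "(pi / t) powr (DIM('a) / 2) = sqrt (pi / t) ^ DIM('a)"
      using t by (simp add: powr_half_sqrt[symmetric] powr_power)
    moreover have "exp (- (norm z)\<^sup>2 / (4 * t)) = (\<Prod>b\<in>Basis. exp (- (z \<bullet> b)\<^sup>2 / (4 * t)))"
      using exp_sq[of "- 1 / (4 * t)" z] by simp
    ultimately show ?thesis by (simp add: prod.distrib)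
  qed
  finally show ?thesis .
qed

lemma gaussian_integral:
  assumes t: "t > 0"
  shows "has_bochner_integral lborel (\<lambda>x::'a::euclidean_space. exp (- t * (norm x)\<^sup>2)) ((pi / t) powr (DIM('a) / 2))"
  using has_bochner_integral_Re[OF gaussian_fourier[OF t, of "0::'a"]] by simp

lemma nn_integral_gaussian:
  fixes y :: "'a::euclidean_space"
  assumes t: "t > 0"
  shows "(\<integral>\<^sup>+x. ennreal (exp (- t * (norm (y - x))\<^sup>2)) \<partial>lborel)
    = ennreal ((pi / t) powr (DIM('a) / 2))"
proof -
  have "(\<integral>\<^sup>+x. ennreal (exp (- t * (norm (y - x))\<^sup>2)) \<partial>lborel)
     = (\<integral>\<^sup>+x. ennreal (exp (- t * (norm (y - x))\<^sup>2)) \<partial>(distr lborel borel ((+) y)))"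
    by (simp add: lborel_distr_plus)
  also have "\<dots> = (\<integral>\<^sup>+x. ennreal (exp (- t * (norm (x::'a))\<^sup>2)) \<partial>lborel)"
    by (subst nn_integral_distr) auto
  also have "\<dots> = ennreal ((pi / t) powr (DIM('a) / 2))"
    using gaussian_integral[OF t, where 'a='a]
    by (subst nn_integral_eq_integral) (auto simp: has_bochner_integral_iff)
  finally show ?thesis .
qed

subsection \<open>The Bessel potential as a mixture of Gaussians\<close>

lemma has_bochner_integral_Gamma_scaled:
  fixes a s :: real
  assumes a: "a > 0" and s: "s > 0"
  shows "has_bochner_integral lborel (\<lambda>t. indicator {0<..} t * (t powr (a - 1) * exp (- (s * t)))) (Gamma a / s powr a)"
proof -
  have "has_bochner_integral lborel (\<lambda>t. indicator {0..} t * t powr (a - 1) / exp t) (Gamma a)"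
    using Gamma_conv_nn_integral_real[OF a] Gamma_real_pos[OF a]
    by (intro has_bochner_integral_nn_integral) (auto simp: less_imp_le)
  then have "has_bochner_integral lborel (\<lambda>t. indicator {0..} (0 + s * t) * (0 + s * t) powr (a - 1) / exp (0 + s * t)) (Gamma a /\<^sub>R \<bar>s\<bar>)"
    using s by (subst (asm) lborel_has_bochner_integral_real_affine_iff[where c=s and t=0]) auto
  then have "has_bochner_integral lborel
      (\<lambda>t. (indicator {0..} (0 + s * t) * (0 + s * t) powr (a - 1) / exp (0 + s * t)) / s powr (a - 1))
      ((Gamma a /\<^sub>R \<bar>s\<bar>) / s powr (a - 1))"
    by (rule has_bochner_integral_divide_zero)
  \<comment> \<open>The closed and the open half line give the same function even at t = 0, because
    \<open>0 powr (a - 1)\<close> is 0 for every \<open>a\<close>.\<close>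
  also have "(\<lambda>t. (indicator {0..} (0 + s * t) * (0 + s * t) powr (a - 1) / exp (0 + s * t)) / s powr (a - 1))
      = (\<lambda>t. indicator {0<..} t * (t powr (a - 1) * exp (- (s * t))))"
    using s by (auto simp: fun_eq_iff indicator_def powr_mult exp_minus field_simps zero_le_mult_iff)
  also have "(Gamma a /\<^sub>R \<bar>s\<bar>) / s powr (a - 1) = Gamma a / s powr a"
    using s by (simp add: powr_diff field_simps)
  finally show ?thesis .
qed

text \<open>For \<nu> = \<alpha> - n/2 and z = |x| this is (4 pi)^(n/2) t^(\<alpha>-1) exp(-t) times
  the heat kernel at time \<open>t\<close>. Integrating over \<open>t\<close> therefore gives the
  kernel of (1 - Laplacian)^(-\<alpha>) up to the factor (4 pi)^(n/2) Gamma(\<alpha>).\<close>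

definition bessel_kernel :: "real \<Rightarrow> real \<Rightarrow> real \<Rightarrow> real" where
  "bessel_kernel \<nu> z t = indicator {0<..} t * (t powr (\<nu> - 1) * exp (- t - z\<^sup>2 / (4 * t)))"

lemma bessel_kernel_nonneg: "0 \<le> bessel_kernel \<nu> z t"
  by (simp add: bessel_kernel_def)

lemma measurable_bessel_kernel [measurable]:
  assumes [measurable]: "f \<in> borel_measurable M" "g \<in> borel_measurable M"
  shows "(\<lambda>x. bessel_kernel \<nu> (f x) (g x)) \<in> borel_measurable M"
  unfolding bessel_kernel_def by measurable

text \<open>The kernel at z = 0 is the common majorant behind integrability, the limit at 0 and the
  boundedness of \<open>besselG\<close>.\<close>

lemma bessel_kernel_le: "bessel_kernel \<nu> z t \<le> bessel_kernel \<nu> 0 t"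
  unfolding bessel_kernel_def by (auto simp: indicator_def intro!: mult_left_mono)

lemma bessel_kernel_0:
  assumes "\<nu> > 0"
  shows "has_bochner_integral lborel (bessel_kernel \<nu> 0) (Gamma \<nu>)"
  using has_bochner_integral_Gamma_scaled[OF assms, of 1] by (simp add: bessel_kernel_def[abs_def])

lemma integrable_bessel_kernel:
  assumes "\<nu> > 0"
  shows "integrable lborel (bessel_kernel \<nu> z)"
proof (rule Bochner_Integration.integrable_bound)
  show "integrable lborel (bessel_kernel \<nu> 0)"
    using bessel_kernel_0[OF assms] by (simp add: has_bochner_integral_iff)
  show "AE t in lborel. norm (bessel_kernel \<nu> z t) \<le> norm (bessel_kernel \<nu> 0 t)"
    by (simp add: bessel_kernel_nonneg bessel_kernel_le)
qed measurable

lemma besselK_eq_integral_bessel_kernel: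
  assumes \<nu>: "\<nu> > 0" and z: "z > 0"
  shows "(LINT t|lborel. bessel_kernel \<nu> z t) = 2 * (z / 2) powr \<nu> * besselK \<nu> z"
proof -
  \<comment> \<open>Substitute \<open>t = (z / 2) exp s\<close>, so that \<open>t + z\<^sup>2 / (4 t) = z cosh s\<close>.\<close>
  define f where "f s = (z / 2) powr \<nu> * (exp (- z * cosh s) * exp (\<nu> * s))" for s :: real
  define g where "g t = ln (2 * t / z)" for t :: real
  have f_g: "f (g t) * (1 / t) = bessel_kernel \<nu> z t" if "t > 0" for t
  proof -
    have e: "exp (g t) = 2 * t / z" using that z by (simp add: g_def)
    then have "cosh (g t) = (2 * t / z + z / (2 * t)) / 2"
      by (simp add: cosh_def exp_minus)
    then have "- z * cosh (g t) = - t - z\<^sup>2 / (4 * t)"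
      using that z by (simp add: field_simps power2_eq_square)
    moreover have "(z / 2) powr \<nu> * exp (\<nu> * g t) = t powr \<nu>"
      using that z by (simp add: g_def powr_def ln_div ln_mult algebra_simps flip: exp_add)
    moreover have "t powr \<nu> / t = t powr (\<nu> - 1)" using that by (simp add: powr_diff)
    ultimately show ?thesis using that
      by (simp add: f_def bessel_kernel_def mult.assoc[symmetric] mult.commute)
  qed
  have ind: "indicator {0<..} t *\<^sub>R (f (g t) * (1 / t)) = bessel_kernel \<nu> z t" for t
    using f_g[of t] by (cases "t > 0") (auto simp: bessel_kernel_def)
  have set_int: "set_integrable lborel (einterval 0 \<infinity>) (\<lambda>t. f (g t) * (1 / t))"
    using integrable_bessel_kernel[OF \<nu>, of z]
    unfolding set_integrable_def zero_ereal_def einterval_eq ind by simp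
  have lim0: "((ereal \<circ> g \<circ> real_of_ereal) \<longlongrightarrow> - \<infinity>) (at_right 0)"
  proof -
    have "filterlim g at_bot (at_right 0)"
      unfolding g_def
      by (rule filterlim_compose[OF ln_at_0], rule tendsto_imp_filterlim_at_right)
         (use z in \<open>auto intro!: tendsto_eq_intros simp: eventually_at_right_less eventually_at_filter\<close>)
    then show ?thesis by (simp add: zero_ereal_def ereal_tendsto_simps)
  qed
  have limI: "((ereal \<circ> g \<circ> real_of_ereal) \<longlongrightarrow> \<infinity>) (at_left \<infinity>)"
  proof -
    have "filterlim (\<lambda>t. 2 / z * t) at_top at_top"
      by (rule filterlim_tendsto_pos_mult_at_top[OF tendsto_const _ filterlim_ident]) (use z in auto)
    then have "filterlim g at_top at_top"
      unfolding g_def using filterlim_compose[OF ln_at_top] by simp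
    then show ?thesis by (simp add: ereal_tendsto_simps)
  qed
  have deriv: "DERIV g t :> 1 / t" if "0 < ereal t" "ereal t < \<infinity>" for t
    unfolding g_def using that z by (auto intro!: derivative_eq_intros simp: field_simps)
  have cont: "isCont f (g t)" for t
    unfolding f_def cosh_def by (intro continuous_intros) auto
  have cont': "isCont (\<lambda>t. 1 / t) t" if "0 < ereal t" for t :: real
    using that by (intro continuous_intros) auto
  have nonneg: "0 \<le> f (g t)" "0 \<le> ereal t \<Longrightarrow> 0 \<le> 1 / t" for t
    by (simp_all add: f_def)
  \<comment> \<open>The change of variables is read as s = ln(2t/z), from \<open>t\<close> to
    \<open>s\<close>, because integrability is known on the \<open>t\<close> side. It then yields
    integrability of \<open>f\<close> together with the equality of the integrals.\<close>
  note substitution = interval_integral_substitution_nonneg[where f=f and g=g and g'="\<lambda>t. 1 / t"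
      and a=0 and b=\<infinity> and A="-\<infinity>" and B=\<infinity>, OF _ deriv cont cont' nonneg(1) nonneg(2) lim0 limI set_int]
  have "set_integrable lborel (einterval (-\<infinity>) \<infinity>) f"
    by (rule substitution) auto
  moreover have "(LBINT x=-\<infinity>..\<infinity>. f x) = (LBINT t=0..\<infinity>. f (g t) * (1 / t))"
    by (rule substitution) auto
  ultimately have "set_integrable lborel (einterval (-\<infinity>) \<infinity>) f \<and> (LBINT x=-\<infinity>..\<infinity>. f x) = (LBINT t=0..\<infinity>. f (g t) * (1 / t))"
    by simp
  then have f: "has_bochner_integral lborel f (LINT t|lborel. bessel_kernel \<nu> z t)"
    unfolding interval_lebesgue_integral_def has_bochner_integral_iff set_integrable_def
      set_lebesgue_integral_def zero_ereal_def einterval_eq ind by simp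
  \<comment> \<open>\<open>f\<close> carries exp(\<nu> s) on the whole line. Averaging with its
    reflection produces the even function \<open>h\<close> with \<open>cosh\<close>, and evenness
    halves the integral to the half line used in \<open>besselK\<close>.\<close>
  then have f': "has_bochner_integral lborel (\<lambda>s. f (- s)) (LINT t|lborel. bessel_kernel \<nu> z t)"
    using lborel_has_bochner_integral_real_affine_iff[of "-1" f _ 0] by simp
  define h where "h s = exp (- z * cosh s) * cosh (\<nu> * s)" for s :: real
  have "has_bochner_integral lborel (\<lambda>s. (f s + f (- s)) / (2 * (z / 2) powr \<nu>))
      (((LINT t|lborel. bessel_kernel \<nu> z t) + (LINT t|lborel. bessel_kernel \<nu> z t)) / (2 * (z / 2) powr \<nu>))"
    by (intro has_bochner_integral_divide_zero has_bochner_integral_add f f')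
  also have "(\<lambda>s. (f s + f (- s)) / (2 * (z / 2) powr \<nu>)) = h"
  proof
    fix s
    have cosh: "cosh (\<nu> * s) = (exp (\<nu> * s) + exp (- (\<nu> * s))) / 2"
      by (simp add: cosh_def)
    show "(f s + f (- s)) / (2 * (z / 2) powr \<nu>) = h s"
      unfolding f_def h_def cosh using z by (simp add: field_simps)
  qed
  finally have h: "has_bochner_integral lborel h ((LINT t|lborel. bessel_kernel \<nu> z t) / (z / 2) powr \<nu>)"
    by simp
  have "integrable lborel (\<lambda>s. indicator {0..} s *\<^sub>R h s)"
    using h by (intro integrable_mult_indicator) (auto simp: has_bochner_integral_iff)
  then have "has_bochner_integral lborel (\<lambda>s. indicator {0..} s *\<^sub>R h s) (besselK \<nu> z)"
    by (simp add: has_bochner_integral_iff besselK_def set_lebesgue_integral_def h_def)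
  then have "has_bochner_integral lborel h (2 *\<^sub>R besselK \<nu> z)"
    by (rule has_bochner_integral_even_function) (simp add: h_def)
  from has_bochner_integral_eq[OF h this] show ?thesis
    using z by (simp add: field_simps)
qed

text \<open>Writing 2^(\<gamma>-1+n/2) as 2^(\<nu>-1) 2^n separates the normalization: 2^(\<nu>-1)
  is absorbed by the factor 2 (z/2)^\<nu> of the Bessel integral, and 2^n = 4^(n/2) joins pi^(n/2)
  to form the heat kernel constant.\<close>

lemma bessel_profile_eq_integral_bessel_kernel:
  assumes \<gamma>: "\<gamma> > real n / 2" and z: "z > 0"
  shows "bessel_profile n \<gamma> z
    = (LINT t|lborel. bessel_kernel (\<gamma> - real n / 2) z t) / ((4 * pi) powr (real n / 2) * Gamma \<gamma>)"
proof -
  define \<nu> where "\<nu> = \<gamma> - real n / 2"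
  have "(2::real) powr (\<gamma> - 1 + real n / 2) = 2 powr (\<nu> - 1) * 2 powr real n"
    using powr_add[of "2::real" "\<nu> - 1" "real n"] by (simp add: \<nu>_def algebra_simps)
  moreover have "(4::real) powr (real n / 2) = 2 powr real n"
    using powr_powr[of 2 2 "real n / 2"] by simp
  moreover have "2 * (z / 2) powr \<nu> = z powr \<nu> / 2 powr (\<nu> - 1)"
    using z by (simp add: powr_divide powr_diff)
  ultimately show ?thesis
    using besselK_eq_integral_bessel_kernel[of \<nu> z] \<gamma> z
    by (simp add: bessel_profile_def \<nu>_def[symmetric] powr_mult) (simp add: \<nu>_def mult_ac)
qed

subsection \<open>The Plancherel inequality\<close>

text \<open>Supplies the absolute integrability for the Fubini exchanges in
  \<open>plancherel_gaussian\<close>, where \<phi> is a phase that couples the two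
  variables.\<close>

lemma integrable_product_bounded:
  fixes a :: "'a::euclidean_space \<Rightarrow> complex" and b :: "'b::euclidean_space \<Rightarrow> complex"
  assumes a: "integrable lborel a" and b: "integrable lborel b"
    and [measurable]: "case_prod \<phi> \<in> borel_measurable (lborel \<Otimes>\<^sub>M lborel)"
    and \<phi>: "\<And>x y. cmod (\<phi> x y) \<le> 1"
  shows "integrable (lborel \<Otimes>\<^sub>M lborel) (\<lambda>(x, y). a x * b y * \<phi> x y)"
proof (rule Bochner_Integration.integrable_bound)
  have [measurable]: "a \<in> borel_measurable borel" "b \<in> borel_measurable borel"
    using a b by auto
  show "integrable (lborel \<Otimes>\<^sub>M lborel) (\<lambda>(x, y). a x * b y)"
  proof (rule lborel_pair.Fubini_integrable)
    show "integrable lborel (\<lambda>x. LINT y|lborel. norm (case (x, y) of (x, y) \<Rightarrow> a x * b y))"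
      using a b by (simp add: norm_mult)
    show "AE x in lborel. integrable lborel (\<lambda>y. case (x, y) of (x, y) \<Rightarrow> a x * b y)"
      using b by simp
  qed measurable
  show "(\<lambda>(x, y). a x * b y * \<phi> x y) \<in> borel_measurable (lborel \<Otimes>\<^sub>M lborel)"
    by measurable
  show "AE p in lborel \<Otimes>\<^sub>M lborel. norm (case p of (x, y) \<Rightarrow> a x * b y * \<phi> x y) \<le> norm (case p of (x, y) \<Rightarrow> a x * b y)"
    using \<phi> by (intro AE_I2) (auto simp: norm_mult split: prod.split intro!: mult_left_le)
qed

lemma borel_measurable_cnj [measurable]:
  assumes "f \<in> borel_measurable M"
  shows "(\<lambda>x. cnj (f x)) \<in> borel_measurable M"
  by (rule borel_measurable_continuous_on[OF _ assms]) (intro continuous_intros)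

lemma measurable_fourier_L1 [measurable]:
  fixes u :: "real^'n \<Rightarrow> complex"
  assumes [measurable]: "u \<in> borel_measurable borel"
  shows "fourier_L1 u \<in> borel_measurable borel"
  unfolding fourier_L1_def[abs_def] cis_conv_exp by measurable

lemma integrable_fourier_L1_integrand:
  fixes u :: "real^'n \<Rightarrow> complex"
  assumes "integrable lborel u"
  shows "integrable lborel (\<lambda>x. cis (- (\<xi> \<bullet> x)) * u x)"
proof (rule Bochner_Integration.integrable_bound[OF assms])
  have [measurable]: "u \<in> borel_measurable borel" using assms by auto
  show "(\<lambda>x. cis (- (\<xi> \<bullet> x)) * u x) \<in> borel_measurable lborel"
    unfolding cis_conv_exp by measurable
qed (simp add: norm_mult)

lemma norm_fourier_L1_le:
  fixes u :: "real^'n \<Rightarrow> complex"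
  shows "cmod (fourier_L1 u \<xi>) \<le> (LINT x|lborel. cmod (u x))"
proof -
  have "cmod (fourier_L1 u \<xi>) \<le> (LINT x|lborel. cmod (cis (- (\<xi> \<bullet> x)) * u x))"
    unfolding fourier_L1_def by (rule integral_norm_bound)
  then show ?thesis by (simp add: norm_mult)
qed

lemma fourier_L1_diff:
  fixes u v :: "real^'n \<Rightarrow> complex"
  assumes "integrable lborel u" "integrable lborel v"
  shows "fourier_L1 (\<lambda>x. u x - v x) \<xi> = fourier_L1 u \<xi> - fourier_L1 v \<xi>"
  using integrable_fourier_L1_integrand[OF assms(1)] integrable_fourier_L1_integrand[OF assms(2)]
  by (simp add: fourier_L1_def right_diff_distrib)

lemma integrable_bounded_times_gaussian:
  fixes h :: "'a::euclidean_space \<Rightarrow> complex"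
  assumes "t > 0" and [measurable]: "h \<in> borel_measurable borel" and "\<And>x. cmod (h x) \<le> C"
  shows "integrable lborel (\<lambda>x. h x * complex_of_real (exp (- t * (norm x)\<^sup>2)))"
proof (rule Bochner_Integration.integrable_bound)
  show "integrable lborel (\<lambda>x::'a. C * exp (- t * (norm x)\<^sup>2))"
    using gaussian_integral[OF assms(1), where 'a='a]
    by (intro integrable_mult_right) (auto simp: has_bochner_integral_iff)
  have "0 \<le> C" using norm_ge_zero assms(3) by (rule order_trans)
  then show "AE x in lborel. norm (h x * complex_of_real (exp (- t * (norm x)\<^sup>2))) \<le> norm (C * exp (- t * (norm x)\<^sup>2))"
    using assms(3) by (auto simp: norm_mult intro!: mult_right_mono)
qed measurable

text \<open>
  The Gaussian factor makes all integrals absolutely convergent. After Fubini the left-hand side is the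
  quadratic form of \<open>u\<close> for a convolution kernel of total mass \<open>(2 * pi) ^ CARD('n)\<close>, to which Schur's test applies.
\<close>
lemma plancherel_gaussian:
  fixes u :: "real^'n \<Rightarrow> complex"
  assumes u: "integrable lborel u" and u2: "integrable lborel (\<lambda>x. (cmod (u x))\<^sup>2)" and \<epsilon>: "\<epsilon> > 0"
  shows "(\<integral>\<^sup>+\<xi>. ennreal (exp (- \<epsilon> * (norm \<xi>)\<^sup>2) * (cmod (fourier_L1 u \<xi>))\<^sup>2) \<partial>lborel)
    \<le> ennreal ((2 * pi) ^ CARD('n) * (LINT x|lborel. (cmod (u x))\<^sup>2))"
proof -
  have [measurable]: "u \<in> borel_measurable borel" using u by auto
  define e where "e \<xi> = complex_of_real (exp (- \<epsilon> * (norm \<xi>)\<^sup>2))" for \<xi> :: "real^'n"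
  have [measurable]: "e \<in> borel_measurable borel" unfolding e_def[abs_def] by measurable
  have e: "integrable lborel e"
    using gaussian_integral[OF \<epsilon>, where 'a="real^'n"] unfolding e_def[abs_def]
    by (intro integrable_of_real) (simp add: has_bochner_integral_iff)
  define g where "g z = (pi / \<epsilon>) powr (CARD('n) / 2) * exp (- (norm z)\<^sup>2 / (4 * \<epsilon>))" for z :: "real^'n"
  have [measurable]: "g \<in> borel_measurable borel" unfolding g_def[abs_def] by measurable
  have g_nonneg: "0 \<le> g z" for z by (simp add: g_def)
  have g_sym: "g (x - y) = g (y - x)" for x y by (simp add: g_def norm_minus_commute)
  have fourier_e: "(LINT \<xi>|lborel. cis (- (z \<bullet> \<xi>)) * e \<xi>) = complex_of_real (g z)" for z
    using gaussian_fourier[OF \<epsilon>, of z] by (simp add: has_bochner_integral_iff e_def g_def)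
  \<comment> \<open>The mass is (pi/\<epsilon>)^(n/2) (4 pi \<epsilon>)^(n/2) = (2 pi)^n. That
    \<epsilon> cancels is what makes the final bound survive \<epsilon> -> 0.\<close>
  have g_int: "(\<integral>\<^sup>+y. ennreal (g (x - y)) \<partial>lborel) = ennreal ((2 * pi) ^ CARD('n))" for x
  proof -
    have "(\<integral>\<^sup>+y. ennreal (g (x - y)) \<partial>lborel)
      = ennreal ((pi / \<epsilon>) powr (CARD('n) / 2)) * (\<integral>\<^sup>+y. ennreal (exp (- (1 / (4 * \<epsilon>)) * (norm (x - y))\<^sup>2)) \<partial>lborel)"
      unfolding g_def by (subst nn_integral_cmult[symmetric]) (auto simp: ennreal_mult)
    also have "\<dots> = ennreal ((pi / \<epsilon>) powr (CARD('n) / 2) * (pi / (1 / (4 * \<epsilon>))) powr (CARD('n) / 2))"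
      using \<epsilon> by (subst nn_integral_gaussian) (auto simp: ennreal_mult)
    also have "(pi / \<epsilon>) powr (CARD('n) / 2) * (pi / (1 / (4 * \<epsilon>))) powr (CARD('n) / 2)
      = ((2 * pi) powr 2) powr (CARD('n) / 2)"
      using \<epsilon> by (subst powr_mult[symmetric]) (auto simp: power2_eq_square powr_numeral mult_ac)
    also have "\<dots> = (2 * pi) ^ CARD('n)"
      by (simp only: powr_powr) (simp add: powr_realpow)
    finally show ?thesis .
  qed
  define U where "U = fourier_L1 u"
  have [measurable]: "U \<in> borel_measurable borel" unfolding U_def by measurable
  define C where "C = (LINT x|lborel. cmod (u x))"
  have U_le: "cmod (U \<xi>) \<le> C" for \<xi>
    unfolding U_def C_def by (rule norm_fourier_L1_le)
  \<comment> \<open>\<open>H\<close> keeps only the conjugated factor of |U|^2. The other factor is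
    expanded in \<open>I\<close>, and the one inside \<open>H\<close> in \<open>J\<close>, so that
    each exchange involves just two variables.\<close>
  define H where "H \<xi> = cnj (U \<xi>) * e \<xi>" for \<xi>
  have H: "integrable lborel H"
    unfolding H_def e_def using U_le by (intro integrable_bounded_times_gaussian \<epsilon>) auto
  define J where "J x = (LINT \<xi>|lborel. H \<xi> * cis (- (\<xi> \<bullet> x)))" for x
  have J: "J x = (LINT y|lborel. cnj (u y) * g (x - y))" for x
  proof -
    have "J x = (LINT \<xi>|lborel. (LINT y|lborel. e \<xi> * cnj (u y) * cis (- (\<xi> \<bullet> (x - y)))))"
      unfolding J_def
    proof (rule Bochner_Integration.integral_cong[OF refl])
      fix \<xi>
      have "H \<xi> * cis (- (\<xi> \<bullet> x)) = e \<xi> * cis (- (\<xi> \<bullet> x)) * (LINT y|lborel. cnj (cis (- (\<xi> \<bullet> y)) * u y))"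
        unfolding Bochner_Integration.integral_cnj H_def U_def fourier_L1_def by (simp only: mult_ac)
      also have "\<dots> = (LINT y|lborel. e \<xi> * cis (- (\<xi> \<bullet> x)) * cnj (cis (- (\<xi> \<bullet> y)) * u y))"
        by (rule integral_mult_right_zero[symmetric])
      also have "\<dots> = (LINT y|lborel. e \<xi> * cnj (u y) * cis (- (\<xi> \<bullet> (x - y))))"
      proof (rule Bochner_Integration.integral_cong[OF refl])
        fix y
        have "cis (- (\<xi> \<bullet> (x - y))) = cis (- (\<xi> \<bullet> x)) * cis (\<xi> \<bullet> y)"
          by (simp add: cis_mult inner_diff_right)
        then show "e \<xi> * cis (- (\<xi> \<bullet> x)) * cnj (cis (- (\<xi> \<bullet> y)) * u y) = e \<xi> * cnj (u y) * cis (- (\<xi> \<bullet> (x - y)))"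
          by (simp add: cis_cnj)
      qed
      finally show "H \<xi> * cis (- (\<xi> \<bullet> x)) = (LINT y|lborel. e \<xi> * cnj (u y) * cis (- (\<xi> \<bullet> (x - y))))" .
    qed
    also have "\<dots> = (LINT y|lborel. (LINT \<xi>|lborel. e \<xi> * cnj (u y) * cis (- (\<xi> \<bullet> (x - y)))))"
    proof (rule lborel_pair.Fubini_integral[symmetric], rule integrable_product_bounded[OF e])
      show "integrable lborel (\<lambda>y. cnj (u y))" using u by simp
      show "(\<lambda>(\<xi>, y). cis (- (\<xi> \<bullet> (x - y)))) \<in> borel_measurable (lborel \<Otimes>\<^sub>M lborel)"
        unfolding cis_conv_exp by measurable
    qed simp
    also have "\<dots> = (LINT y|lborel. cnj (u y) * g (x - y))"
    proof (rule Bochner_Integration.integral_cong[OF refl])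
      fix y
      have "(LINT \<xi>|lborel. e \<xi> * cnj (u y) * cis (- (\<xi> \<bullet> (x - y))))
        = (LINT \<xi>|lborel. cnj (u y) * (cis (- ((x - y) \<bullet> \<xi>)) * e \<xi>))"
        by (simp add: mult_ac inner_commute)
      also have "\<dots> = cnj (u y) * g (x - y)"
        by (simp only: integral_mult_right_zero fourier_e)
      finally show "(LINT \<xi>|lborel. e \<xi> * cnj (u y) * cis (- (\<xi> \<bullet> (x - y)))) = cnj (u y) * g (x - y)" .
    qed
    finally show ?thesis .
  qed
  have H_u: "integrable (lborel \<Otimes>\<^sub>M lborel) (\<lambda>(\<xi>, x). H \<xi> * u x * cis (- (\<xi> \<bullet> x)))"
  proof (rule integrable_product_bounded[OF H u])
    show "(\<lambda>(\<xi>, x). cis (- (\<xi> \<bullet> x))) \<in> borel_measurable (lborel \<Otimes>\<^sub>M lborel)"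
      unfolding cis_conv_exp by measurable
  qed simp
  have I: "(LINT \<xi>|lborel. H \<xi> * U \<xi>) = (LINT x|lborel. u x * J x)"
  proof -
    have "(LINT \<xi>|lborel. H \<xi> * U \<xi>) = (LINT \<xi>|lborel. (LINT x|lborel. H \<xi> * u x * cis (- (\<xi> \<bullet> x))))"
      unfolding U_def fourier_L1_def integral_mult_right_zero[symmetric]
      by (simp add: mult_ac)
    also have "\<dots> = (LINT x|lborel. (LINT \<xi>|lborel. H \<xi> * u x * cis (- (\<xi> \<bullet> x))))"
      by (rule lborel_pair.Fubini_integral[symmetric, OF H_u])
    also have "\<dots> = (LINT x|lborel. u x * J x)"
      unfolding J_def integral_mult_right_zero[symmetric] by (simp add: mult_ac)
    finally show ?thesis .
  qed
  have HU: "H \<xi> * U \<xi> = complex_of_real (exp (- \<epsilon> * (norm \<xi>)\<^sup>2) * (cmod (U \<xi>))\<^sup>2)" for \<xi>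
    by (simp add: H_def e_def complex_norm_square mult_ac del: of_real_power)
  have HU_int: "integrable lborel (\<lambda>\<xi>. exp (- \<epsilon> * (norm \<xi>)\<^sup>2) * (cmod (U \<xi>))\<^sup>2)"
  proof -
    have "integrable lborel (\<lambda>\<xi>. (cnj (U \<xi>) * U \<xi>) * complex_of_real (exp (- \<epsilon> * (norm \<xi>)\<^sup>2)))"
      using U_le by (intro integrable_bounded_times_gaussian[where C="C * C"] \<epsilon>) (auto simp: norm_mult intro!: mult_mono order_trans[OF norm_ge_zero U_le])
    also have "(\<lambda>\<xi>. (cnj (U \<xi>) * U \<xi>) * complex_of_real (exp (- \<epsilon> * (norm \<xi>)\<^sup>2)))
      = (\<lambda>\<xi>. complex_of_real (exp (- \<epsilon> * (norm \<xi>)\<^sup>2) * (cmod (U \<xi>))\<^sup>2))"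
      unfolding HU[symmetric] by (simp add: H_def e_def mult_ac)
    finally show ?thesis by (simp only: complex_of_real_integrable_eq)
  qed
  let ?N = "\<lambda>x. ennreal ((cmod (u x))\<^sup>2)"
  have N: "(\<integral>\<^sup>+x. ?N x \<partial>lborel) = ennreal (LINT x|lborel. (cmod (u x))\<^sup>2)"
    by (rule nn_integral_eq_integral[OF u2]) simp
  have "(\<integral>\<^sup>+\<xi>. ennreal (exp (- \<epsilon> * (norm \<xi>)\<^sup>2) * (cmod (U \<xi>))\<^sup>2) \<partial>lborel)
    = ennreal (LINT \<xi>|lborel. exp (- \<epsilon> * (norm \<xi>)\<^sup>2) * (cmod (U \<xi>))\<^sup>2)"
    by (rule nn_integral_eq_integral[OF HU_int]) simp
  also have "\<dots> \<le> ennreal (cmod (LINT x|lborel. u x * J x))"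
    unfolding I[symmetric] HU integral_complex_of_real norm_of_real by (rule ennreal_leI) simp
  also have "ennreal (cmod (LINT x|lborel. u x * J x)) \<le> (\<integral>\<^sup>+x. ennreal (cmod (u x * J x)) \<partial>lborel)"
  proof (rule integral_norm_bound_ennreal)
    show "integrable lborel (\<lambda>x. u x * J x)"
      using lborel_pair.integrable_snd[OF H_u] unfolding J_def integral_mult_right_zero[symmetric]
      by (simp add: mult_ac)
  qed
  also have "\<dots> \<le> (\<integral>\<^sup>+x. (\<integral>\<^sup>+y. ennreal ((cmod (u x))\<^sup>2 / 2 * g (x - y)) + ennreal ((cmod (u y))\<^sup>2 / 2 * g (x - y)) \<partial>lborel) \<partial>lborel)"
  proof (rule nn_integral_mono)
    fix x
    have "ennreal (cmod (u x * J x)) = ennreal (cmod (LINT y|lborel. u x * (cnj (u y) * g (x - y))))"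
      unfolding J by simp
    also have "\<dots> \<le> (\<integral>\<^sup>+y. ennreal (cmod (u x * (cnj (u y) * g (x - y)))) \<partial>lborel)"
    proof (rule integral_norm_bound_ennreal)
      show "integrable lborel (\<lambda>y. u x * (cnj (u y) * g (x - y)))"
      proof (rule integrable_mult_right, rule Bochner_Integration.integrable_bound)
        show "integrable lborel (\<lambda>y. (pi / \<epsilon>) powr (CARD('n) / 2) * cmod (u y))"
          using u by simp
        show "AE y in lborel. norm (cnj (u y) * complex_of_real (g (x - y))) \<le> norm ((pi / \<epsilon>) powr (CARD('n) / 2) * cmod (u y))"
        proof (rule AE_I2)
          fix y
          have "g (x - y) \<le> (pi / \<epsilon>) powr (CARD('n) / 2)"
            using \<epsilon> by (simp add: g_def mult_left_le)
          from mult_right_mono[OF this, of "cmod (u y)"] g_nonneg[of "x - y"]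
          show "norm (cnj (u y) * complex_of_real (g (x - y))) \<le> norm ((pi / \<epsilon>) powr (CARD('n) / 2) * cmod (u y))"
            by (simp add: norm_mult mult.commute)
        qed
      qed measurable
    qed
    also have "\<dots> \<le> (\<integral>\<^sup>+y. ennreal ((cmod (u x))\<^sup>2 / 2 * g (x - y)) + ennreal ((cmod (u y))\<^sup>2 / 2 * g (x - y)) \<partial>lborel)"
    proof (rule nn_integral_mono)
      fix y
      have "cmod (u x) * cmod (u y) \<le> (cmod (u x))\<^sup>2 / 2 + (cmod (u y))\<^sup>2 / 2"
        using sum_squares_bound[of "cmod (u x)" "cmod (u y)"] by simp
      then have "cmod (u x) * cmod (u y) * g (x - y) \<le> ((cmod (u x))\<^sup>2 / 2 + (cmod (u y))\<^sup>2 / 2) * g (x - y)"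
        using g_nonneg by (rule mult_right_mono)
      then have "ennreal (cmod (u x * (cnj (u y) * complex_of_real (g (x - y)))))
          \<le> ennreal ((cmod (u x))\<^sup>2 / 2 * g (x - y) + (cmod (u y))\<^sup>2 / 2 * g (x - y))"
        using g_nonneg by (intro ennreal_leI) (simp add: norm_mult distrib_right mult.assoc)
      also have "\<dots> = ennreal ((cmod (u x))\<^sup>2 / 2 * g (x - y)) + ennreal ((cmod (u y))\<^sup>2 / 2 * g (x - y))"
        using g_nonneg by (intro ennreal_plus) auto
      finally show "ennreal (cmod (u x * (cnj (u y) * complex_of_real (g (x - y)))))
        \<le> ennreal ((cmod (u x))\<^sup>2 / 2 * g (x - y)) + ennreal ((cmod (u y))\<^sup>2 / 2 * g (x - y))" .
    qed
    finally show "ennreal (cmod (u x * J x)) \<le> \<dots>" .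
  qed
  also have "\<dots> = (\<integral>\<^sup>+x. (\<integral>\<^sup>+y. ennreal ((cmod (u x))\<^sup>2 / 2 * g (x - y)) \<partial>lborel) \<partial>lborel)
      + (\<integral>\<^sup>+x. (\<integral>\<^sup>+y. ennreal ((cmod (u y))\<^sup>2 / 2 * g (x - y)) \<partial>lborel) \<partial>lborel)"
    by (simp add: nn_integral_add)
  also have "(\<integral>\<^sup>+x. (\<integral>\<^sup>+y. ennreal ((cmod (u y))\<^sup>2 / 2 * g (x - y)) \<partial>lborel) \<partial>lborel)
    = (\<integral>\<^sup>+y. (\<integral>\<^sup>+x. ennreal ((cmod (u y))\<^sup>2 / 2 * g (x - y)) \<partial>lborel) \<partial>lborel)"
    by (rule lborel_pair.Fubini') measurable
  also have "\<dots> = (\<integral>\<^sup>+y. (\<integral>\<^sup>+x. ennreal ((cmod (u y))\<^sup>2 / 2 * g (y - x)) \<partial>lborel) \<partial>lborel)"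
    by (subst g_sym) (rule refl)
  also have "(\<integral>\<^sup>+x. (\<integral>\<^sup>+y. ennreal ((cmod (u x))\<^sup>2 / 2 * g (x - y)) \<partial>lborel) \<partial>lborel)
    + (\<integral>\<^sup>+y. (\<integral>\<^sup>+x. ennreal ((cmod (u y))\<^sup>2 / 2 * g (y - x)) \<partial>lborel) \<partial>lborel)
    = 2 * (\<integral>\<^sup>+x. (\<integral>\<^sup>+y. ennreal ((cmod (u x))\<^sup>2 / 2) * ennreal (g (x - y)) \<partial>lborel) \<partial>lborel)"
    unfolding mult_2 by (subst (1 2) ennreal_mult) (auto simp: g_nonneg)
  also have "\<dots> = 2 * (\<integral>\<^sup>+x. ennreal ((cmod (u x))\<^sup>2 / 2) * ennreal ((2 * pi) ^ CARD('n)) \<partial>lborel)"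
    by (simp add: nn_integral_cmult g_int)
  also have "\<dots> = (\<integral>\<^sup>+x. ennreal ((2 * pi) ^ CARD('n)) * ?N x \<partial>lborel)"
    by (subst nn_integral_cmult[symmetric])
       (auto intro!: nn_integral_cong simp: ennreal_mult[symmetric] ennreal_numeral[symmetric] simp del: ennreal_numeral)
  also have "\<dots> = ennreal ((2 * pi) ^ CARD('n) * (LINT x|lborel. (cmod (u x))\<^sup>2))"
    by (subst nn_integral_cmult) (auto simp: N ennreal_mult)
  finally show ?thesis unfolding U_def .
qed

text \<open>Fatou's lemma along \<epsilon> = 1/(k+1), since the damped bound is uniform in
  \<epsilon>. The finite constant turns L2 convergence of truncations into L2 convergence of their
  transforms.\<close>

theorem plancherel_le:
  fixes u :: "real^'n \<Rightarrow> complex"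
  assumes u: "integrable lborel u" and u2: "integrable lborel (\<lambda>x. (cmod (u x))\<^sup>2)"
  shows "integrable lborel (\<lambda>\<xi>. (cmod (fourier_L1 u \<xi>))\<^sup>2)"
    and "(LINT \<xi>|lborel. (cmod (fourier_L1 u \<xi>))\<^sup>2) \<le> (2 * pi) ^ CARD('n) * (LINT x|lborel. (cmod (u x))\<^sup>2)"
proof -
  have [measurable]: "u \<in> borel_measurable borel" using u by auto
  define C where "C = (2 * pi) ^ CARD('n) * (LINT x|lborel. (cmod (u x))\<^sup>2)"
  define F where "F k \<xi> = ennreal (exp (- (1 / real (Suc k)) * (norm \<xi>)\<^sup>2) * (cmod (fourier_L1 u \<xi>))\<^sup>2)" for k \<xi>
  have [measurable]: "F k \<in> borel_measurable borel" for k unfolding F_def[abs_def] by measurable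
  have C: "0 \<le> C" by (simp add: C_def)
  have "(\<lambda>k. exp (- (1 / real (Suc k)) * (norm \<xi>)\<^sup>2) * (cmod (fourier_L1 u \<xi>))\<^sup>2)
      \<longlonglongrightarrow> exp (- 0 * (norm \<xi>)\<^sup>2) * (cmod (fourier_L1 u \<xi>))\<^sup>2" for \<xi>
    by (intro tendsto_intros filterlim_compose[OF lim_1_over_n filterlim_Suc])
  then have lim: "(\<lambda>k. F k \<xi>) \<longlonglongrightarrow> ennreal ((cmod (fourier_L1 u \<xi>))\<^sup>2)" for \<xi>
    unfolding F_def by (intro tendsto_ennrealI) simp
  have "(\<integral>\<^sup>+\<xi>. ennreal ((cmod (fourier_L1 u \<xi>))\<^sup>2) \<partial>lborel) = (\<integral>\<^sup>+\<xi>. liminf (\<lambda>k. F k \<xi>) \<partial>lborel)"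
    by (intro nn_integral_cong lim_imp_Liminf[symmetric] lim) simp
  also have "\<dots> \<le> liminf (\<lambda>k. \<integral>\<^sup>+\<xi>. F k \<xi> \<partial>lborel)"
    by (rule nn_integral_liminf) measurable
  also have "\<dots> \<le> limsup (\<lambda>k. \<integral>\<^sup>+\<xi>. F k \<xi> \<partial>lborel)"
    by (rule Liminf_le_Limsup) simp
  also have "\<dots> \<le> ennreal C"
    unfolding F_def C_def
    by (intro Limsup_bounded always_eventually allI plancherel_gaussian u u2) simp
  finally have le: "(\<integral>\<^sup>+\<xi>. ennreal ((cmod (fourier_L1 u \<xi>))\<^sup>2) \<partial>lborel) \<le> ennreal C" .
  show int: "integrable lborel (\<lambda>\<xi>. (cmod (fourier_L1 u \<xi>))\<^sup>2)"
    using le by (intro integrableI_bounded) (auto simp: less_top[symmetric] top_unique)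
  have "ennreal (LINT \<xi>|lborel. (cmod (fourier_L1 u \<xi>))\<^sup>2) \<le> ennreal C"
    using le by (subst (asm) nn_integral_eq_integral[OF int]) auto
  then show "(LINT \<xi>|lborel. (cmod (fourier_L1 u \<xi>))\<^sup>2) \<le> (2 * pi) ^ CARD('n) * (LINT x|lborel. (cmod (u x))\<^sup>2)"
    using C by (simp add: C_def)
qed

subsection \<open>Gaussian Gram matrices of separated points\<close>

text \<open>Moving the centre by \<delta>/2 costs a doubled variance and a constant factor, because
  |y - z|^2 \<le> 2 |y - x|^2 + \<delta>^2/2. The factor is exp(\<delta>^2/(16 t)), and
  \<open>t \<ge> 1\<close> makes it independent of \<open>t\<close>.\<close>

lemma gaussian_le_translate:
  fixes x y z :: "'a::real_normed_vector"
  assumes "dist x z < \<delta> / 2" and t: "t \<ge> 1"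
  shows "exp (- (norm (y - x))\<^sup>2 / (4 * t)) \<le> exp (\<delta>\<^sup>2 / 16) * exp (- (1 / (8 * t)) * (norm (y - z))\<^sup>2)"
proof -
  have "norm (y - z) \<le> norm (y - x) + norm (x - z)"
    using norm_triangle_ineq[of "y - x" "x - z"] by simp
  also have "\<dots> \<le> norm (y - x) + \<delta> / 2"
    using assms by (simp add: dist_norm)
  finally have "(norm (y - z))\<^sup>2 \<le> (norm (y - x) + \<delta> / 2)\<^sup>2"
    by (rule power_mono) simp
  also have "\<dots> \<le> 2 * (norm (y - x))\<^sup>2 + \<delta>\<^sup>2 / 2"
    using sum_squares_bound[of "norm (y - x)" "\<delta> / 2"] by (simp add: power2_sum power_divide)
  finally have "- (norm (y - x))\<^sup>2 / (4 * t) \<le> (\<delta>\<^sup>2 / 2 - (norm (y - z))\<^sup>2) / (8 * t)"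
    using t by (simp add: field_simps)
  also have "\<dots> = \<delta>\<^sup>2 / 16 / t + - (1 / (8 * t)) * (norm (y - z))\<^sup>2"
    using t by (simp add: field_simps)
  also have "\<delta>\<^sup>2 / 16 / t \<le> \<delta>\<^sup>2 / 16"
    using t by (simp add: field_simps mult_le_cancel_right1)
  finally show ?thesis by (simp flip: exp_add)
qed

text \<open>For \<open>t \<ge> 1\<close> the sum is compared with a Gaussian integral over the disjoint balls around the \<open>X k\<close>.\<close>
lemma separated_gaussian_sum_bound:
  fixes X :: "nat \<Rightarrow> 'a::euclidean_space"
  assumes \<delta>: "\<delta> > 0" and sep: "\<And>j k. j \<noteq> k \<Longrightarrow> \<delta> \<le> dist (X j) (X k)"
  obtains C where "C > 0"
    "\<And>S y t. finite S \<Longrightarrow> t > 0 \<Longrightarrow>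
      (\<Sum>k\<in>S. exp (- (norm (y - X k))\<^sup>2 / (4 * t))) \<le> C * (1 + t powr (DIM('a) / 2))"
proof -
  define V where "V = measure lborel (ball (0::'a) (\<delta> / 2))"
  have V: "V > 0" using \<delta> by (simp add: V_def content_ball_pos)
  have ball: "emeasure lborel (ball x (\<delta> / 2)) = ennreal V" for x :: 'a
    using content_ball_conv_unit_ball[of "\<delta> / 2" x] content_ball_conv_unit_ball[of "\<delta> / 2" "0::'a"] \<delta>
      emeasure_lborel_ball_finite[of x "\<delta> / 2"] by (simp add: V_def emeasure_eq_ennreal_measure less_top)
  define E where "E = exp (\<delta>\<^sup>2 / 16)"
  have E: "E > 0" by (simp add: E_def)
  \<comment> \<open>The widened Gaussian exp(-|.|^2/(8t)) has mass (8 pi t)^(n/2). Each point claims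
    a ball of volume \<open>V\<close>, and \<open>E\<close> is the price of replacing its value at
    the centre by values on that ball.\<close>
  define C where "C = E * (8 * pi) powr (DIM('a) / 2) / V"
  have C: "C > 0" using E V by (simp add: C_def)
  have large: "(\<Sum>k\<in>S. exp (- (norm (y - X k))\<^sup>2 / (4 * t))) \<le> C * t powr (DIM('a) / 2)"
    if S: "finite S" and t: "t \<ge> 1" for S y t
  proof -
    define e where "e k = exp (- (norm (y - X k))\<^sup>2 / (4 * t))" for k
    have e: "0 \<le> e k" for k by (simp add: e_def)
    have pt: "(\<Sum>k\<in>S. ennreal (e k) * indicator (ball (X k) (\<delta> / 2)) z)
      \<le> ennreal (E * exp (- (1 / (8 * t)) * (norm (y - z))\<^sup>2))" for z
    proof (cases "\<exists>k\<in>S. z \<in> ball (X k) (\<delta> / 2)")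
      case True
      then obtain k where k: "k \<in> S" "z \<in> ball (X k) (\<delta> / 2)" by blast
      have "z \<notin> ball (X j) (\<delta> / 2)" if "j \<noteq> k" for j
        using sep[OF that] k dist_triangle_half_l[of "X j" z \<delta> "X k"] by (auto simp: dist_commute)
      then have "(\<Sum>k\<in>S. ennreal (e k) * indicator (ball (X k) (\<delta> / 2)) z) = (\<Sum>j\<in>{k}. ennreal (e j))"
        using k S by (intro sum.mono_neutral_cong_right) (auto simp: indicator_def)
      also have "\<dots> \<le> ennreal (E * exp (- (1 / (8 * t)) * (norm (y - z))\<^sup>2))"
        using gaussian_le_translate[of "X k" z \<delta> t y] k t by (auto simp: e_def E_def intro!: ennreal_leI)
      finally show ?thesis .
    next
      case False
      then show ?thesis by (subst sum.neutral) (auto simp: indicator_def)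
    qed
    have "ennreal ((\<Sum>k\<in>S. e k) * V) = (\<Sum>k\<in>S. ennreal (e k) * emeasure lborel (ball (X k) (\<delta> / 2)))"
      using V e by (simp add: ball sum_distrib_right ennreal_mult' flip: sum_ennreal)
    also have "\<dots> = (\<integral>\<^sup>+z. (\<Sum>k\<in>S. ennreal (e k) * indicator (ball (X k) (\<delta> / 2)) z) \<partial>lborel)"
      by (subst nn_integral_sum, measurable) (auto simp: nn_integral_cmult_indicator)
    also have "\<dots> \<le> (\<integral>\<^sup>+z. ennreal E * ennreal (exp (- (1 / (8 * t)) * (norm (y - z))\<^sup>2)) \<partial>lborel)"
      using pt E by (intro nn_integral_mono) (simp add: ennreal_mult'[symmetric])
    also have "\<dots> = ennreal E * ennreal ((pi / (1 / (8 * t))) powr (DIM('a) / 2))"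
      using t by (subst nn_integral_cmult, simp, subst nn_integral_gaussian) auto
    also have "\<dots> = ennreal (C * t powr (DIM('a) / 2) * V)"
      using E V t by (simp add: ennreal_mult'[symmetric] C_def powr_mult mult_ac)
    finally have "(\<Sum>k\<in>S. e k) * V \<le> C * t powr (DIM('a) / 2) * V"
      using C V by (subst (asm) ennreal_le_iff) auto
    then show ?thesis using V by (simp add: e_def)
  qed
  have "(\<Sum>k\<in>S. exp (- (norm (y - X k))\<^sup>2 / (4 * t))) \<le> C * (1 + t powr (DIM('a) / 2))"
    if S: "finite S" and t: "t > 0" for S y t
  proof (cases "t \<ge> 1")
    case True
    then show ?thesis using large[OF S True, of y] C by (simp add: distrib_left)
  next
    case False
    \<comment> \<open>Every term increases with \<open>t\<close>, so the value at t = 1 bounds the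
      sum for all smaller \<open>t\<close>.\<close>
    then have "(\<Sum>k\<in>S. exp (- (norm (y - X k))\<^sup>2 / (4 * t))) \<le> (\<Sum>k\<in>S. exp (- (norm (y - X k))\<^sup>2 / (4 * 1)))"
      using t by (intro sum_mono) (auto simp: field_simps mult_left_le_one_le)
    also have "\<dots> \<le> C * 1 powr (DIM('a) / 2)"
      by (rule large[OF S]) simp
    also have "\<dots> \<le> C * (1 + t powr (DIM('a) / 2))"
      using C by simp
    finally show ?thesis .
  qed
  with C show ?thesis by (rule that)
qed

text \<open>From a_j a_k \<le> (a_j^2 + a_k^2)/2; by symmetry of \<open>g\<close> both halves are
  the same weighted row sum. It is applied to the full Gaussian matrix for the upper bound and to
  its off-diagonal part for the lower one.\<close>

lemma schur_test:
  fixes a :: "'i \<Rightarrow> real" and g :: "'i \<Rightarrow> 'i \<Rightarrow> real"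
  assumes g: "\<And>j k. g j k = g k j" "\<And>j k. 0 \<le> g j k"
    and row: "\<And>j. j \<in> S \<Longrightarrow> (\<Sum>k\<in>S. g j k) \<le> M"
  shows "(\<Sum>j\<in>S. \<Sum>k\<in>S. a j * a k * g j k) \<le> M * (\<Sum>j\<in>S. (a j)\<^sup>2)"
proof -
  have "(\<Sum>j\<in>S. \<Sum>k\<in>S. a j * a k * g j k) \<le> (\<Sum>j\<in>S. \<Sum>k\<in>S. (a j)\<^sup>2 / 2 * g j k + (a k)\<^sup>2 / 2 * g k j)"
  proof (intro sum_mono)
    fix j k
    have "a j * a k \<le> (a j)\<^sup>2 / 2 + (a k)\<^sup>2 / 2"
      using sum_squares_bound[of "a j" "a k"] by simp
    from mult_right_mono[OF this g(2)[of j k]]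
    show "a j * a k * g j k \<le> (a j)\<^sup>2 / 2 * g j k + (a k)\<^sup>2 / 2 * g k j"
      by (simp add: distrib_right g(1)[of k j])
  qed
  also have "\<dots> = (\<Sum>j\<in>S. \<Sum>k\<in>S. (a j)\<^sup>2 / 2 * g j k) + (\<Sum>j\<in>S. \<Sum>k\<in>S. (a k)\<^sup>2 / 2 * g k j)"
    by (simp add: sum.distrib)
  also have "(\<Sum>j\<in>S. \<Sum>k\<in>S. (a k)\<^sup>2 / 2 * g k j) = (\<Sum>j\<in>S. \<Sum>k\<in>S. (a j)\<^sup>2 / 2 * g j k)"
    by (rule sum.swap)
  also have "(\<Sum>j\<in>S. \<Sum>k\<in>S. (a j)\<^sup>2 / 2 * g j k) + (\<Sum>j\<in>S. \<Sum>k\<in>S. (a j)\<^sup>2 / 2 * g j k)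
      = (\<Sum>j\<in>S. (a j)\<^sup>2 * (\<Sum>k\<in>S. g j k))"
    by (simp add: sum_distrib_left sum_distrib_right mult.commute flip: sum.distrib)
  also have "\<dots> \<le> (\<Sum>j\<in>S. (a j)\<^sup>2 * M)"
    by (intro sum_mono mult_left_mono row) auto
  finally show ?thesis by (simp add: sum_distrib_left mult_ac)
qed

section \<open>Quadratic forms of Gaussian Gram matrices\<close>

definition trig_sum :: "'i set \<Rightarrow> ('i \<Rightarrow> complex) \<Rightarrow> ('i \<Rightarrow> 'a::real_inner) \<Rightarrow> 'a \<Rightarrow> complex" where
  "trig_sum S c X \<xi> = (\<Sum>j\<in>S. c j * cis (- (X j \<bullet> \<xi>)))"

lemma measurable_trig_sum [measurable]:
  fixes X :: "'i \<Rightarrow> 'a::euclidean_space"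
  shows "trig_sum S c X \<in> borel_measurable borel"
  unfolding trig_sum_def[abs_def] cis_conv_exp by measurable

text \<open>Swapping \<open>j\<close> and \<open>k\<close> conjugates the coefficient and fixes the
  exponential, so the full Hermitian form is real. Termwise real parts make it real valued without
  changing it.\<close>

definition gaussian_form :: "'i set \<Rightarrow> ('i \<Rightarrow> complex) \<Rightarrow> ('i \<Rightarrow> 'a::real_normed_vector) \<Rightarrow> real \<Rightarrow> real" where
  "gaussian_form S c X t = (\<Sum>j\<in>S. \<Sum>k\<in>S. Re (c j * cnj (c k)) * exp (- (norm (X j - X k))\<^sup>2 / (4 * t)))"

text \<open>Expanding the square leaves phases whose frequencies are the differences of the points.
  As the integrand is nonnegative, this is also why the Gaussian Gram matrices are positive
  semidefinite.\<close>

lemma integral_trig_sum_gaussian: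
  fixes X :: "'i \<Rightarrow> 'a::euclidean_space"
  assumes t: "t > 0"
  shows "has_bochner_integral lborel (\<lambda>\<xi>. (cmod (trig_sum S c X \<xi>))\<^sup>2 * exp (- t * (norm \<xi>)\<^sup>2))
    ((pi / t) powr (DIM('a) / 2) * gaussian_form S c X t)"
proof -
  have "has_bochner_integral lborel
      (\<lambda>\<xi>. \<Sum>j\<in>S. \<Sum>k\<in>S. (c j * cnj (c k)) * (cis (- ((X j - X k) \<bullet> \<xi>)) * complex_of_real (exp (- t * (norm \<xi>)\<^sup>2))))
      (\<Sum>j\<in>S. \<Sum>k\<in>S. (c j * cnj (c k)) * complex_of_real ((pi / t) powr (DIM('a) / 2) * exp (- (norm (X j - X k))\<^sup>2 / (4 * t))))"
    by (intro has_bochner_integral_sum has_bochner_integral_mult_right gaussian_fourier t)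
  from has_bochner_integral_Re[OF this]
  have "has_bochner_integral lborel
      (\<lambda>\<xi>. Re (\<Sum>j\<in>S. \<Sum>k\<in>S. (c j * cnj (c k)) * (cis (- ((X j - X k) \<bullet> \<xi>)) * complex_of_real (exp (- t * (norm \<xi>)\<^sup>2)))))
      (Re (\<Sum>j\<in>S. \<Sum>k\<in>S. (c j * cnj (c k)) * complex_of_real ((pi / t) powr (DIM('a) / 2) * exp (- (norm (X j - X k))\<^sup>2 / (4 * t)))))" .
  also have "(\<lambda>\<xi>. Re (\<Sum>j\<in>S. \<Sum>k\<in>S. (c j * cnj (c k)) * (cis (- ((X j - X k) \<bullet> \<xi>)) * complex_of_real (exp (- t * (norm \<xi>)\<^sup>2)))))
      = (\<lambda>\<xi>. (cmod (trig_sum S c X \<xi>))\<^sup>2 * exp (- t * (norm \<xi>)\<^sup>2))"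
  proof
    fix \<xi>
    have cis: "cis (- ((X j - X k) \<bullet> \<xi>)) = cis (- (X j \<bullet> \<xi>)) * cnj (cis (- (X k \<bullet> \<xi>)))" for j k
      by (simp add: cis_cnj cis_mult inner_diff_left)
    have "complex_of_real ((cmod (trig_sum S c X \<xi>))\<^sup>2) = trig_sum S c X \<xi> * cnj (trig_sum S c X \<xi>)"
      by (simp add: complex_norm_square del: of_real_power)
    also have "\<dots> = (\<Sum>j\<in>S. \<Sum>k\<in>S. (c j * cnj (c k)) * cis (- ((X j - X k) \<bullet> \<xi>)))"
      unfolding trig_sum_def cis cnj_sum sum_product by (simp add: mult_ac)
    finally have "complex_of_real ((cmod (trig_sum S c X \<xi>))\<^sup>2 * exp (- t * (norm \<xi>)\<^sup>2))
        = (\<Sum>j\<in>S. \<Sum>k\<in>S. (c j * cnj (c k)) * (cis (- ((X j - X k) \<bullet> \<xi>)) * complex_of_real (exp (- t * (norm \<xi>)\<^sup>2))))"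
      unfolding of_real_mult by (simp only: sum_distrib_right mult.assoc)
    then show "Re (\<Sum>j\<in>S. \<Sum>k\<in>S. (c j * cnj (c k)) * (cis (- ((X j - X k) \<bullet> \<xi>)) * complex_of_real (exp (- t * (norm \<xi>)\<^sup>2))))
        = (cmod (trig_sum S c X \<xi>))\<^sup>2 * exp (- t * (norm \<xi>)\<^sup>2)"
      by (metis Re_complex_of_real)
  qed
  also have "Re (\<Sum>j\<in>S. \<Sum>k\<in>S. (c j * cnj (c k)) * complex_of_real ((pi / t) powr (DIM('a) / 2) * exp (- (norm (X j - X k))\<^sup>2 / (4 * t))))
      = (pi / t) powr (DIM('a) / 2) * gaussian_form S c X t"
    unfolding gaussian_form_def Re_sum sum_distrib_left
    by (intro sum.cong refl) (simp only: Re_complex_of_real times_complex.sel complex_of_real_def complex.sel, simp add: mult_ac)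
  finally show ?thesis .
qed

lemma abs_Re_mult_cnj_le: "\<bar>Re (a * cnj b)\<bar> \<le> cmod a * cmod b"
  using abs_Re_le_cmod[of "a * cnj b"] by (simp add: norm_mult)

text \<open>For the lower bound the diagonal contributes the full sum of squares. As
  \<open>t\<close> tends to 0 separation makes the off-diagonal row sums tend to 0 uniformly, and
  once they are at most 1/2 they can destroy at most half of it.\<close>

lemma gaussian_form_bounds:
  fixes X :: "nat \<Rightarrow> 'a::euclidean_space"
  assumes \<delta>: "\<delta> > 0" and sep: "\<And>j k. j \<noteq> k \<Longrightarrow> \<delta> \<le> dist (X j) (X k)"
  obtains C t0 where "C > 0" "t0 > 0"
    "\<And>S c t. finite S \<Longrightarrow> t > 0 \<Longrightarrow> gaussian_form S c X t \<le> C * (1 + t powr (DIM('a) / 2)) * (\<Sum>j\<in>S. (cmod (c j))\<^sup>2)"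
    "\<And>S c t. finite S \<Longrightarrow> 0 < t \<Longrightarrow> t \<le> t0 \<Longrightarrow> (\<Sum>j\<in>S. (cmod (c j))\<^sup>2) / 2 \<le> gaussian_form S c X t"
proof -
  obtain C where C: "C > 0"
    and sum_le: "\<And>S y t. finite S \<Longrightarrow> t > 0 \<Longrightarrow>
      (\<Sum>k\<in>S. exp (- (norm (y - X k))\<^sup>2 / (4 * t))) \<le> C * (1 + t powr (DIM('a) / 2))"
    by (rule separated_gaussian_sum_bound[of \<delta> X]) (use \<delta> sep in blast)+
  \<comment> \<open>The value 1/2 ensures 2t \<le> 1, so the Gaussian sum at scale 2t is at most 2C.
    The other value makes the row bound (8t/\<delta>^2) (2C) at most 1/2.\<close>
  define t0 where "t0 = min (1 / 2) (\<delta>\<^sup>2 / (32 * C))"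
  have t0: "t0 > 0" using C \<delta> by (simp add: t0_def)
  have upper: "gaussian_form S c X t \<le> C * (1 + t powr (DIM('a) / 2)) * (\<Sum>j\<in>S. (cmod (c j))\<^sup>2)"
    if S: "finite S" and t: "t > 0" for S c t
  proof -
    have "gaussian_form S c X t \<le> (\<Sum>j\<in>S. \<Sum>k\<in>S. cmod (c j) * cmod (c k) * exp (- (norm (X j - X k))\<^sup>2 / (4 * t)))"
      unfolding gaussian_form_def
      by (intro sum_mono mult_right_mono order_trans[OF abs_ge_self abs_Re_mult_cnj_le]) auto
    also have "\<dots> \<le> C * (1 + t powr (DIM('a) / 2)) * (\<Sum>j\<in>S. (cmod (c j))\<^sup>2)"
      by (intro schur_test sum_le S t) (auto simp: norm_minus_commute)
    finally show ?thesis .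
  qed
  have lower: "(\<Sum>j\<in>S. (cmod (c j))\<^sup>2) / 2 \<le> gaussian_form S c X t"
    if S: "finite S" and t: "0 < t" "t \<le> t0" for S c t
  proof -
    define g where "g j k = (if j = k then 0 else exp (- (norm (X j - X k))\<^sup>2 / (4 * t)))" for j k
    have row: "(\<Sum>k\<in>S. g j k) \<le> 1 / 2" for j
    proof -
      \<comment> \<open>Half of the exponent is spent on the separation, giving a factor that
        vanishes as \<open>t\<close> tends to 0. The other half is a Gaussian at scale 2t, kept to
        make the sum over \<open>k\<close> bounded.\<close>
      have "(\<Sum>k\<in>S. g j k) \<le> (\<Sum>k\<in>S. exp (- \<delta>\<^sup>2 / (8 * t)) * exp (- (norm (X j - X k))\<^sup>2 / (4 * (2 * t))))"
      proof (rule sum_mono)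
        fix k
        show "g j k \<le> exp (- \<delta>\<^sup>2 / (8 * t)) * exp (- (norm (X j - X k))\<^sup>2 / (4 * (2 * t)))"
        proof (cases "j = k")
          case False
          have "\<delta>\<^sup>2 \<le> (norm (X j - X k))\<^sup>2"
            using sep[OF False] \<delta> by (intro power_mono) (auto simp: dist_norm)
          then have "- (norm (X j - X k))\<^sup>2 / (4 * t) \<le> - \<delta>\<^sup>2 / (8 * t) + - (norm (X j - X k))\<^sup>2 / (4 * (2 * t))"
            using t by (simp add: field_simps)
          then show ?thesis using False by (simp add: g_def flip: exp_add)
        qed (simp add: g_def)
      qed
      also have "\<dots> = exp (- \<delta>\<^sup>2 / (8 * t)) * (\<Sum>k\<in>S. exp (- (norm (X j - X k))\<^sup>2 / (4 * (2 * t))))"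
        by (simp add: sum_distrib_left)
      also have "\<dots> \<le> (8 * t / \<delta>\<^sup>2) * (C * 2)"
      proof (rule mult_mono)
        have "\<delta>\<^sup>2 / (8 * t) \<le> exp (\<delta>\<^sup>2 / (8 * t))"
          using exp_ge_add_one_self[of "\<delta>\<^sup>2 / (8 * t)"] by linarith
        then show "exp (- \<delta>\<^sup>2 / (8 * t)) \<le> 8 * t / \<delta>\<^sup>2"
          using t \<delta> by (simp add: exp_minus field_simps)
        have "(2 * t) powr (DIM('a) / 2) \<le> 1 powr (DIM('a) / 2)"
          using t by (intro powr_mono2) (auto simp: t0_def)
        then have "C * (1 + (2 * t) powr (DIM('a) / 2)) \<le> C * 2"
          using C by (intro mult_left_mono) auto
        with sum_le[OF S, of "2 * t" "X j"] t
        show "(\<Sum>k\<in>S. exp (- (norm (X j - X k))\<^sup>2 / (4 * (2 * t)))) \<le> C * 2" by simp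
      qed (use t in \<open>auto intro!: sum_nonneg\<close>)
      also have "\<dots> \<le> 1 / 2"
        using t C \<delta> by (simp add: t0_def field_simps)
      finally show ?thesis .
    qed
    have "- (\<Sum>j\<in>S. \<Sum>k\<in>S. cmod (c j) * cmod (c k) * g j k)
      = (\<Sum>j\<in>S. \<Sum>k\<in>S. - (cmod (c j) * cmod (c k)) * g j k)"
      by (simp add: sum_negf)
    also have "\<dots> \<le> (\<Sum>j\<in>S. \<Sum>k\<in>S. Re (c j * cnj (c k)) * g j k)"
    proof (intro sum_mono mult_right_mono)
      fix j k
      show "- (cmod (c j) * cmod (c k)) \<le> Re (c j * cnj (c k))"
        using abs_Re_mult_cnj_le[of "c j" "c k"] by linarith
    qed (auto simp: g_def)
    finally have offdiag: "- (\<Sum>j\<in>S. \<Sum>k\<in>S. cmod (c j) * cmod (c k) * g j k) \<le> (\<Sum>j\<in>S. \<Sum>k\<in>S. Re (c j * cnj (c k)) * g j k)" .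
    have schur: "(\<Sum>j\<in>S. \<Sum>k\<in>S. cmod (c j) * cmod (c k) * g j k) \<le> 1 / 2 * (\<Sum>j\<in>S. (cmod (c j))\<^sup>2)"
      by (intro schur_test row) (auto simp: g_def norm_minus_commute)
    have diag: "Re (c j * cnj (c j)) = (cmod (c j))\<^sup>2" for j
      by (metis Re_complex_of_real complex_norm_square)
    have "gaussian_form S c X t = (\<Sum>j\<in>S. \<Sum>k\<in>S. (if j = k then (cmod (c j))\<^sup>2 else 0) + Re (c j * cnj (c k)) * g j k)"
      unfolding gaussian_form_def
      by (intro sum.cong refl) (auto simp: g_def diag simp del: times_complex.sel)
    also have "\<dots> = (\<Sum>j\<in>S. (cmod (c j))\<^sup>2) + (\<Sum>j\<in>S. \<Sum>k\<in>S. Re (c j * cnj (c k)) * g j k)"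
      using S by (simp add: sum.distrib sum.delta)
    finally show ?thesis using offdiag schur by linarith
  qed
  show ?thesis using that[OF C t0 upper lower] .
qed

subsection \<open>Trigonometric sums in weighted spaces\<close>

lemma Gamma_mixture:
  assumes \<alpha>: "\<alpha> > 0" and r: "r \<ge> 0"
  shows "(\<integral>\<^sup>+t. ennreal (indicator {0<..} t * (t powr (\<alpha> - 1) * exp (- t)) / Gamma \<alpha> * exp (- t * r)) \<partial>lborel)
    = ennreal ((1 + r) powr (- \<alpha>))"
proof -
  have \<Gamma>: "Gamma \<alpha> > 0" using \<alpha> by (rule Gamma_real_pos)
  have "has_bochner_integral lborel (\<lambda>t. indicator {0<..} t * (t powr (\<alpha> - 1) * exp (- ((1 + r) * t))) / Gamma \<alpha>)
     (Gamma \<alpha> / (1 + r) powr \<alpha> / Gamma \<alpha>)"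
    using \<alpha> r by (intro has_bochner_integral_divide_zero has_bochner_integral_Gamma_scaled) auto
  also have "(\<lambda>t. indicator {0<..} t * (t powr (\<alpha> - 1) * exp (- ((1 + r) * t))) / Gamma \<alpha>)
     = (\<lambda>t. indicator {0<..} t * (t powr (\<alpha> - 1) * exp (- t)) / Gamma \<alpha> * exp (- t * r))"
    by (auto simp: fun_eq_iff distrib_right exp_add exp_diff exp_minus field_simps)
  also have "Gamma \<alpha> / (1 + r) powr \<alpha> / Gamma \<alpha> = (1 + r) powr (- \<alpha>)"
    using \<Gamma> by (simp add: powr_minus_divide)
  finally show ?thesis
    using \<Gamma> by (subst nn_integral_eq_integral) (auto simp: has_bochner_integral_iff intro!: AE_I2 mult_nonneg_nonneg divide_nonneg_pos)
qed

text \<open>Stated with nonnegative integrals so that Tonelli applies before integrability is known.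
  On the right \<open>ennreal\<close> truncates nothing, since for t > 0 the form is itself a
  positive multiple of the integral of a nonnegative function.\<close>

lemma nn_integral_trig_sum_weight:
  fixes X :: "'i \<Rightarrow> 'a::euclidean_space"
  assumes \<alpha>: "\<alpha> > 0"
  shows "(\<integral>\<^sup>+\<xi>. ennreal ((cmod (trig_sum S c X \<xi>))\<^sup>2 * (1 + (norm \<xi>)\<^sup>2) powr (- \<alpha>)) \<partial>lborel)
    = (\<integral>\<^sup>+t. ennreal (pi powr (DIM('a) / 2) / Gamma \<alpha> *
        (indicator {0<..} t * (t powr (\<alpha> - DIM('a) / 2 - 1) * exp (- t))) * gaussian_form S c X t) \<partial>lborel)"
proof -
  have \<Gamma>: "Gamma \<alpha> > 0" using \<alpha> by (rule Gamma_real_pos)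
  define \<phi> where "\<phi> t = indicator {0<..} t * (t powr (\<alpha> - 1) * exp (- t)) / Gamma \<alpha>" for t :: real
  have [measurable]: "\<phi> \<in> borel_measurable borel" unfolding \<phi>_def[abs_def] by measurable
  have \<phi>: "0 \<le> \<phi> t" for t using \<Gamma> by (simp add: \<phi>_def)
  let ?P = "trig_sum S c X"
  have "(\<integral>\<^sup>+\<xi>. ennreal ((cmod (?P \<xi>))\<^sup>2 * (1 + (norm \<xi>)\<^sup>2) powr (- \<alpha>)) \<partial>lborel)
    = (\<integral>\<^sup>+\<xi>. (\<integral>\<^sup>+t. ennreal (\<phi> t * ((cmod (?P \<xi>))\<^sup>2 * exp (- t * (norm \<xi>)\<^sup>2))) \<partial>lborel) \<partial>lborel)"
  proof (rule nn_integral_cong)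
    fix \<xi>
    have "ennreal ((cmod (?P \<xi>))\<^sup>2 * (1 + (norm \<xi>)\<^sup>2) powr (- \<alpha>))
      = ennreal ((cmod (?P \<xi>))\<^sup>2) * (\<integral>\<^sup>+t. ennreal (\<phi> t * exp (- t * (norm \<xi>)\<^sup>2)) \<partial>lborel)"
      unfolding \<phi>_def by (subst Gamma_mixture[OF \<alpha>]) (auto intro!: ennreal_mult)
    also have "\<dots> = (\<integral>\<^sup>+t. ennreal ((cmod (?P \<xi>))\<^sup>2) * ennreal (\<phi> t * exp (- t * (norm \<xi>)\<^sup>2)) \<partial>lborel)"
      by (rule nn_integral_cmult[symmetric]) measurable
    also have "\<dots> = (\<integral>\<^sup>+t. ennreal (\<phi> t * ((cmod (?P \<xi>))\<^sup>2 * exp (- t * (norm \<xi>)\<^sup>2))) \<partial>lborel)"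
      using \<phi> by (intro nn_integral_cong) (simp add: ennreal_mult'[symmetric] mult_ac)
    finally show "ennreal ((cmod (?P \<xi>))\<^sup>2 * (1 + (norm \<xi>)\<^sup>2) powr (- \<alpha>)) = \<dots>" .
  qed
  also have "\<dots> = (\<integral>\<^sup>+t. (\<integral>\<^sup>+\<xi>. ennreal (\<phi> t * ((cmod (?P \<xi>))\<^sup>2 * exp (- t * (norm \<xi>)\<^sup>2))) \<partial>lborel) \<partial>lborel)"
    by (rule lborel_pair.Fubini') measurable
  also have "\<dots> = (\<integral>\<^sup>+t. ennreal (pi powr (DIM('a) / 2) / Gamma \<alpha> *
        (indicator {0<..} t * (t powr (\<alpha> - DIM('a) / 2 - 1) * exp (- t))) * gaussian_form S c X t) \<partial>lborel)"
  proof (rule nn_integral_cong)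
    fix t :: real
    show "(\<integral>\<^sup>+\<xi>. ennreal (\<phi> t * ((cmod (?P \<xi>))\<^sup>2 * exp (- t * (norm \<xi>)\<^sup>2))) \<partial>lborel)
      = ennreal (pi powr (DIM('a) / 2) / Gamma \<alpha> *
        (indicator {0<..} t * (t powr (\<alpha> - DIM('a) / 2 - 1) * exp (- t))) * gaussian_form S c X t)"
    proof (cases "t > 0")
      case True
      have "has_bochner_integral lborel (\<lambda>\<xi>. \<phi> t * ((cmod (?P \<xi>))\<^sup>2 * exp (- t * (norm \<xi>)\<^sup>2)))
        (\<phi> t * ((pi / t) powr (DIM('a) / 2) * gaussian_form S c X t))"
        by (intro has_bochner_integral_mult_right integral_trig_sum_gaussian True)
      moreover have "\<phi> t * (pi / t) powr (DIM('a) / 2)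
        = pi powr (DIM('a) / 2) / Gamma \<alpha> * (indicator {0<..} t * (t powr (\<alpha> - DIM('a) / 2 - 1) * exp (- t)))"
      proof -
        have "t powr (\<alpha> - DIM('a) / 2 - 1) = t powr (\<alpha> - 1) / t powr (DIM('a) / 2)"
          using True by (simp add: powr_diff)
        then show ?thesis using True by (simp add: \<phi>_def powr_divide)
      qed
      ultimately show ?thesis
        using \<phi>[of t]
        by (subst nn_integral_eq_integral) (auto simp: has_bochner_integral_iff mult.assoc[symmetric])
    qed (simp add: \<phi>_def)
  qed
  finally show ?thesis .
qed

text \<open>The estimates for each \<open>t\<close> are uniform in \<open>S\<close> and
  \<open>c\<close>, and the weight in \<open>t\<close> does not involve them. Near t = 0 the weight
  is integrable because \<alpha> > n/2; at infinity exp(-t) absorbs the growth t^(n/2) of the row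
  sums.\<close>

theorem trig_sum_weight_bounds:
  fixes X :: "nat \<Rightarrow> 'a::euclidean_space"
  assumes \<alpha>: "\<alpha> > DIM('a) / 2"
    and \<delta>: "\<delta> > 0" and sep: "\<And>j k. j \<noteq> k \<Longrightarrow> \<delta> \<le> dist (X j) (X k)"
  obtains A B where "0 < A"
    "\<And>S c. finite S \<Longrightarrow> integrable lborel (\<lambda>\<xi>. (cmod (trig_sum S c X \<xi>))\<^sup>2 * (1 + (norm \<xi>)\<^sup>2) powr (- \<alpha>))"
    "\<And>S c. finite S \<Longrightarrow> A * (\<Sum>j\<in>S. (cmod (c j))\<^sup>2)
       \<le> (LINT \<xi>|lborel. (cmod (trig_sum S c X \<xi>))\<^sup>2 * (1 + (norm \<xi>)\<^sup>2) powr (- \<alpha>))"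
    "\<And>S c. finite S \<Longrightarrow> (LINT \<xi>|lborel. (cmod (trig_sum S c X \<xi>))\<^sup>2 * (1 + (norm \<xi>)\<^sup>2) powr (- \<alpha>))
       \<le> B * (\<Sum>j\<in>S. (cmod (c j))\<^sup>2)"
proof -
  obtain C t0 where C: "C > 0" and t0: "t0 > 0"
    and upper: "\<And>S c t. finite S \<Longrightarrow> t > 0 \<Longrightarrow> gaussian_form S c X t \<le> C * (1 + t powr (DIM('a) / 2)) * (\<Sum>j\<in>S. (cmod (c j))\<^sup>2)"
    and lower: "\<And>S c t. finite S \<Longrightarrow> 0 < t \<Longrightarrow> t \<le> t0 \<Longrightarrow> (\<Sum>j\<in>S. (cmod (c j))\<^sup>2) / 2 \<le> gaussian_form S c X t"
    by (rule gaussian_form_bounds[of \<delta> X]) (use \<delta> sep in blast)+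
  define h where "h = real DIM('a) / 2"
  define p where "p = \<alpha> - h"
  have p: "p > 0" and h: "h \<ge> 0" using \<alpha> by (simp_all add: p_def h_def)
  have \<alpha>0: "\<alpha> > 0" using p h by (simp add: p_def)
  have \<Gamma>: "Gamma \<alpha> > 0" "Gamma p > 0" using \<alpha>0 p by (simp_all add: Gamma_real_pos)
  define D where "D = pi powr h / Gamma \<alpha>"
  have D: "D > 0" using \<Gamma> by (simp add: D_def)
  define \<psi> where "\<psi> t = indicator {0<..} t * (t powr (p - 1) * exp (- t))" for t :: real
  have \<psi>: "0 \<le> \<psi> t" for t by (simp add: \<psi>_def)
  \<comment> \<open>On the window [t0/2, t0] the weight \<psi> is at least (t0/2)^p exp(-t0)/t0; the
    form supplies the factor 1/2 and the window its length t0/2. The power t^(p-1) is split as t^p /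
    t because p - 1 may be negative.\<close>
  define A where "A = D * ((t0 / 2) powr p * exp (- t0) / t0) / 2 * (t0 / 2)"
  \<comment> \<open>The two Gamma values are the integrals of t^(p-1) exp(-t) and t^(p-1) t^h
    exp(-t), as p + h = \<alpha>.\<close>
  define B where "B = D * C * (Gamma p + Gamma \<alpha>)"
  have A: "A > 0" using D t0 by (simp add: A_def)
  have B: "B > 0" using D C \<Gamma> by (simp add: B_def add_pos_pos)
  let ?F = "\<lambda>S c \<xi>. (cmod (trig_sum S c X \<xi>))\<^sup>2 * (1 + (norm \<xi>)\<^sup>2) powr (- \<alpha>)"
  have nn_F: "(\<integral>\<^sup>+\<xi>. ennreal (?F S c \<xi>) \<partial>lborel) = (\<integral>\<^sup>+t. ennreal (D * \<psi> t * gaussian_form S c X t) \<partial>lborel)" for S c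
    using nn_integral_trig_sum_weight[OF \<alpha>0, of S c X] by (simp add: D_def \<psi>_def p_def h_def)
  have nn_upper: "(\<integral>\<^sup>+\<xi>. ennreal (?F S c \<xi>) \<partial>lborel) \<le> ennreal (B * (\<Sum>j\<in>S. (cmod (c j))\<^sup>2))" if S: "finite S" for S c
  proof -
    define K where "K = (\<Sum>j\<in>S. (cmod (c j))\<^sup>2)"
    have K: "0 \<le> K" by (simp add: K_def sum_nonneg)
    have "has_bochner_integral lborel (\<lambda>t. D * C * K * (indicator {0<..} t * (t powr (p - 1) * exp (- (1 * t)))
         + indicator {0<..} t * (t powr (\<alpha> - 1) * exp (- (1 * t))))) (D * C * K * (Gamma p / 1 powr p + Gamma \<alpha> / 1 powr \<alpha>))"
      by (intro has_bochner_integral_mult_right has_bochner_integral_add has_bochner_integral_Gamma_scaled p \<alpha>0) auto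
    then have "has_bochner_integral lborel (\<lambda>t. D * C * K * (\<psi> t
         + indicator {0<..} t * (t powr (\<alpha> - 1) * exp (- t)))) (B * K)"
      by (simp add: \<psi>_def B_def mult_ac)
    then have "(\<integral>\<^sup>+t. ennreal (D * C * K * (\<psi> t + indicator {0<..} t * (t powr (\<alpha> - 1) * exp (- t)))) \<partial>lborel) = ennreal (B * K)"
      using D C K \<psi> by (subst nn_integral_eq_integral) (auto simp: has_bochner_integral_iff)
    moreover have "(\<integral>\<^sup>+t. ennreal (D * \<psi> t * gaussian_form S c X t) \<partial>lborel)
       \<le> (\<integral>\<^sup>+t. ennreal (D * C * K * (\<psi> t + indicator {0<..} t * (t powr (\<alpha> - 1) * exp (- t)))) \<partial>lborel)"
    proof (intro nn_integral_mono ennreal_leI)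
      fix t :: real
      show "D * \<psi> t * gaussian_form S c X t \<le> D * C * K * (\<psi> t + indicator {0<..} t * (t powr (\<alpha> - 1) * exp (- t)))"
      proof (cases "t > 0")
        case True
        have "\<psi> t * t powr h = t powr (\<alpha> - 1) * exp (- t)"
          using True by (simp add: \<psi>_def p_def flip: powr_add)
        moreover have "D * \<psi> t * gaussian_form S c X t \<le> D * \<psi> t * (C * (1 + t powr h) * K)"
          using upper[OF S True, of c] D \<psi>[of t] by (intro mult_left_mono) (auto simp: h_def K_def)
        ultimately show ?thesis using True by (simp add: algebra_simps)
      qed (simp add: \<psi>_def)
    qed
    ultimately show ?thesis by (simp add: nn_F K_def)
  qed
  have nn_lower: "ennreal (A * (\<Sum>j\<in>S. (cmod (c j))\<^sup>2)) \<le> (\<integral>\<^sup>+\<xi>. ennreal (?F S c \<xi>) \<partial>lborel)" if S: "finite S" for S c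
  proof -
    define K where "K = (\<Sum>j\<in>S. (cmod (c j))\<^sup>2)"
    have K: "0 \<le> K" by (simp add: K_def sum_nonneg)
    define a where "a = D * ((t0 / 2) powr p * exp (- t0) / t0)"
    have a: "0 \<le> a" using D t0 by (simp add: a_def)
    have "ennreal (A * K) = ennreal (a * (K / 2)) * ennreal (t0 / 2)"
    proof -
      have "A * K = a * (K / 2) * (t0 / 2)" by (simp add: A_def a_def)
      then show ?thesis using a K t0 by (simp only: ennreal_mult[symmetric] divide_nonneg_pos mult_nonneg_nonneg zero_less_numeral less_imp_le)
    qed
    also have "\<dots> = (\<integral>\<^sup>+t. ennreal (a * (K / 2)) * indicator {t0 / 2..t0} t \<partial>lborel)"
      using t0 by (subst nn_integral_cmult_indicator) auto
    also have "\<dots> \<le> (\<integral>\<^sup>+t. ennreal (D * \<psi> t * gaussian_form S c X t) \<partial>lborel)"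
    proof (rule nn_integral_mono)
      fix t :: real
      show "ennreal (a * (K / 2)) * indicator {t0 / 2..t0} t \<le> ennreal (D * \<psi> t * gaussian_form S c X t)"
      proof (cases "t \<in> {t0 / 2..t0}")
        case True
        then have t: "0 < t" "t0 / 2 \<le> t" "t \<le> t0" using t0 by auto
        have "(t0 / 2) powr p * exp (- t0) / t0 \<le> t powr p * exp (- t) / t"
          using t p t0 by (intro frac_le mult_mono powr_mono2) auto
        also have "\<dots> = \<psi> t" using t by (simp add: \<psi>_def powr_diff)
        finally have "a \<le> D * \<psi> t"
          unfolding a_def using D by (intro mult_left_mono) auto
        then have "a * (K / 2) \<le> D * \<psi> t * gaussian_form S c X t"
          using lower[OF S t(1,3), of c] K a by (intro mult_mono) (auto simp: K_def)
        then show ?thesis using True by (simp add: ennreal_leI)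
      \<comment> \<open>Outside the window the left-hand side is 0. This is where the contribution
        of all other \<open>t\<close> is discarded.\<close>
      qed simp
    qed
    finally show ?thesis by (simp add: nn_F K_def)
  qed
  have [measurable]: "?F S c \<in> borel_measurable borel" for S c by measurable
  have int: "integrable lborel (?F S c)" if S: "finite S" for S c
    using nn_upper[OF S, of c]
    by (intro integrableI_nonneg) (auto simp: less_top[symmetric] top_unique)
  have eq: "(\<integral>\<^sup>+\<xi>. ennreal (?F S c \<xi>) \<partial>lborel) = ennreal (LINT \<xi>|lborel. ?F S c \<xi>)" if S: "finite S" for S c
    by (rule nn_integral_eq_integral[OF int[OF S]]) simp
  show ?thesis
  proof (rule that[OF A int])
    show "A * (\<Sum>j\<in>S. (cmod (c j))\<^sup>2) \<le> (LINT \<xi>|lborel. ?F S c \<xi>)" if S: "finite S" for S c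
      using nn_lower[OF S, of c] unfolding eq[OF S] by (subst (asm) ennreal_le_iff) auto
    show "(LINT \<xi>|lborel. ?F S c \<xi>) \<le> B * (\<Sum>j\<in>S. (cmod (c j))\<^sup>2)" if S: "finite S" for S c
      using nn_upper[OF S, of c] B unfolding eq[OF S] by (subst (asm) ennreal_le_iff) (auto simp: sum_nonneg)
  qed
qed

subsection \<open>The Fourier transform in the mean\<close>

lemma integral_translate:
  fixes f :: "'a::euclidean_space \<Rightarrow> 'b::{banach,second_countable_topology}"
  assumes f: "integrable lborel f"
  shows "has_bochner_integral lborel (\<lambda>x. f (x - a)) (integral\<^sup>L lborel f)"
proof -
  have "has_bochner_integral (distr lborel borel ((+) a)) (\<lambda>x. f (x - a)) (integral\<^sup>L lborel f)"
  proof (rule has_bochner_integral_distr)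
    have [measurable]: "f \<in> borel_measurable borel" using f by auto
    show "(\<lambda>x. f (x - a)) \<in> borel_measurable borel" by measurable
    show "has_bochner_integral lborel (\<lambda>x. f (a + x - a)) (integral\<^sup>L lborel f)"
      using f by (simp add: has_bochner_integral_iff)
  qed measurable
  then show ?thesis by (simp add: lborel_distr_plus)
qed

lemma fourier_L1_translate:
  fixes u :: "real^'n \<Rightarrow> complex"
  assumes u: "integrable lborel u"
  shows "fourier_L1 (\<lambda>x. u (x - a)) \<xi> = cis (- (a \<bullet> \<xi>)) * fourier_L1 u \<xi>"
proof -
  have "fourier_L1 (\<lambda>x. u (x - a)) \<xi> = (LINT x|lborel. cis (- (a \<bullet> \<xi>)) * (cis (- (\<xi> \<bullet> (x - a))) * u (x - a)))"
    unfolding fourier_L1_def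
    by (intro Bochner_Integration.integral_cong refl)
       (simp add: mult.assoc[symmetric] cis_mult inner_diff_right inner_commute)
  also have "\<dots> = cis (- (a \<bullet> \<xi>)) * fourier_L1 u \<xi>"
    unfolding fourier_L1_def integral_mult_right_zero
    using integral_translate[OF integrable_fourier_L1_integrand[OF u], of \<xi> a]
    by (simp add: has_bochner_integral_iff)
  finally show ?thesis .
qed

lemma fourier_L1_sum:
  fixes u :: "'i \<Rightarrow> real^'n \<Rightarrow> complex"
  assumes "\<And>j. j \<in> S \<Longrightarrow> integrable lborel (u j)"
  shows "fourier_L1 (\<lambda>x. \<Sum>j\<in>S. c j * u j x) \<xi> = (\<Sum>j\<in>S. c j * fourier_L1 (u j) \<xi>)"
proof -
  have "fourier_L1 (\<lambda>x. \<Sum>j\<in>S. c j * u j x) \<xi> = (LINT x|lborel. (\<Sum>j\<in>S. c j * (cis (- (\<xi> \<bullet> x)) * u j x)))"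
    unfolding fourier_L1_def by (simp add: sum_distrib_left mult_ac)
  also have "\<dots> = (\<Sum>j\<in>S. c j * fourier_L1 (u j) \<xi>)"
    unfolding fourier_L1_def
    by (subst Bochner_Integration.integral_sum) (auto intro!: integrable_fourier_L1_integrand assms)
  finally show ?thesis .
qed

lemma cut_off_integrable:
  fixes u :: "real^'n \<Rightarrow> complex"
  assumes u: "integrable lborel u" and u2: "integrable lborel (\<lambda>x. (cmod (u x))\<^sup>2)"
  shows "integrable lborel (\<lambda>x. indicator (cball 0 R) x * u x)"
    and "integrable lborel (\<lambda>x. (cmod (indicator (cball 0 R) x * u x))\<^sup>2)"
proof -
  have [measurable]: "u \<in> borel_measurable borel" "cball (0::real^'n) R \<in> sets borel" using u by auto
  show "integrable lborel (\<lambda>x. indicator (cball 0 R) x * u x)"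
  proof (rule Bochner_Integration.integrable_bound[OF u])
    show "(\<lambda>x. indicator (cball 0 R) x * u x) \<in> borel_measurable lborel" by measurable
  qed (simp add: indicator_def)
  show "integrable lborel (\<lambda>x. (cmod (indicator (cball 0 R) x * u x))\<^sup>2)"
  proof (rule Bochner_Integration.integrable_bound[OF u2])
    show "(\<lambda>x. (cmod (indicator (cball 0 R) x * u x))\<^sup>2) \<in> borel_measurable lborel" by measurable
  qed (simp add: indicator_def)
qed

text \<open>The truncation error \<open>d R\<close> tends to 0 in L2 by dominated convergence with
  majorant |u|^2, and \<open>plancherel_le\<close> carries this over to the transforms.\<close>

lemma is_fourier_L2_fourier_L1:
  fixes u :: "real^'n \<Rightarrow> complex"
  assumes u: "integrable lborel u" and u2: "integrable lborel (\<lambda>x. (cmod (u x))\<^sup>2)"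
  shows "is_fourier_L2 u (fourier_L1 u)"
proof -
  have [measurable]: "u \<in> borel_measurable borel" "\<And>R. cball (0::real^'n) R \<in> sets borel" using u by auto
  note cut = cut_off_integrable[OF u u2]
  define d where "d R x = indicator (cball 0 R) x * u x - u x" for R x
  have d: "integrable lborel (d R)" for R unfolding d_def by (intro Bochner_Integration.integrable_diff cut u)
  have d_le: "cmod (d R x) \<le> cmod (u x)" for R x by (auto simp: d_def indicator_def)
  have d2: "integrable lborel (\<lambda>x. (cmod (d R x))\<^sup>2)" for R
    using d[of R] d_le by (intro Bochner_Integration.integrable_bound[OF u2]) (auto intro!: power_mono)
  have "((\<lambda>R. LINT x|lborel. (cmod (d R x))\<^sup>2) \<longlongrightarrow> (LINT x::real^'n|lborel. 0)) at_top"
  proof (rule integral_dominated_convergence_at_top[OF _ _ u2])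
    show "(\<lambda>x. (cmod (d R x))\<^sup>2) \<in> borel_measurable lborel" for R
      unfolding d_def by measurable
    show "\<forall>\<^sub>F R in at_top. AE x in lborel. norm ((cmod (d R x))\<^sup>2) \<le> (cmod (u x))\<^sup>2"
      using d_le by (auto intro!: power_mono)
    have "((\<lambda>R. (cmod (d R x))\<^sup>2) \<longlongrightarrow> 0) at_top" for x
    proof (rule tendsto_eventually)
      show "\<forall>\<^sub>F R in at_top. (cmod (d R x))\<^sup>2 = 0"
        using eventually_ge_at_top[of "norm x"] by eventually_elim (auto simp: d_def)
    qed
    then show "AE x in lborel. ((\<lambda>R. (cmod (d R x))\<^sup>2) \<longlongrightarrow> 0) at_top" by simp
  qed simp
  then have "((\<lambda>R. (2 * pi) ^ CARD('n) * (LINT x|lborel. (cmod (d R x))\<^sup>2)) \<longlongrightarrow> (2 * pi) ^ CARD('n) * 0) at_top"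
    by (intro tendsto_mult tendsto_const) simp
  then have lim: "((\<lambda>R. (2 * pi) ^ CARD('n) * (LINT x|lborel. (cmod (d R x))\<^sup>2)) \<longlongrightarrow> 0) at_top"
    by simp
  have diff: "fourier_L1 (\<lambda>x. indicator (cball 0 R) x * u x) \<xi> - fourier_L1 u \<xi> = fourier_L1 (d R) \<xi>" for R \<xi>
    unfolding d_def by (rule fourier_L1_diff[symmetric, OF cut(1) u])
  have "((\<lambda>R. LINT \<xi>|lborel. (cmod (fourier_L1 (\<lambda>x. indicator (cball 0 R) x * u x) \<xi> - fourier_L1 u \<xi>))\<^sup>2) \<longlongrightarrow> 0) at_top"
    unfolding diff
    by (rule tendsto_sandwich[OF _ _ tendsto_const lim]) (simp, intro always_eventually allI plancherel_le d d2)
  then show ?thesis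
    using plancherel_le(1)[OF u u2] by (simp add: is_fourier_L2_def square_integrable_def)
qed

lemma cmod_add_power2_le: "(cmod (a + b))\<^sup>2 \<le> 2 * (cmod a)\<^sup>2 + 2 * (cmod b)\<^sup>2"
proof -
  have "(cmod (a + b))\<^sup>2 \<le> (cmod a + cmod b)\<^sup>2"
    by (intro power_mono norm_triangle_ineq) simp
  then show ?thesis
    using sum_squares_bound[of "cmod a" "cmod b"] by (simp add: power2_sum)
qed

lemma integrable_cmod_diff_power2:
  assumes "f \<in> borel_measurable M" "g \<in> borel_measurable M"
    and "integrable M (\<lambda>x. (cmod (f x))\<^sup>2)" "integrable M (\<lambda>x. (cmod (g x))\<^sup>2)"
  shows "integrable M (\<lambda>x. (cmod (f x - g x))\<^sup>2)"
proof (rule Bochner_Integration.integrable_bound)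
  show "integrable M (\<lambda>x. 2 * (cmod (f x))\<^sup>2 + 2 * (cmod (g x))\<^sup>2)"
    using assms by simp
  show "(\<lambda>x. (cmod (f x - g x))\<^sup>2) \<in> borel_measurable M"
    using assms(1,2) by measurable
  show "AE x in M. norm ((cmod (f x - g x))\<^sup>2) \<le> norm (2 * (cmod (f x))\<^sup>2 + 2 * (cmod (g x))\<^sup>2)"
    using cmod_add_power2_le[of "f _" "- g _"] by simp
qed

text \<open>
  Since the Bochner integral of a non-integrable function is 0, the limit in \<open>is_fourier_L2\<close> only
  carries information because all the differences are square integrable.
\<close>
lemma is_fourier_L2_unique:
  fixes u :: "real^'n \<Rightarrow> complex"
  assumes u: "integrable lborel u" and u2: "integrable lborel (\<lambda>x. (cmod (u x))\<^sup>2)"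
    and v: "is_fourier_L2 u v" and w: "is_fourier_L2 u w"
  shows "AE \<xi> in lborel. v \<xi> = w \<xi>"
proof -
  define F where "F R = fourier_L1 (\<lambda>x. indicator (cball 0 R) x * u x)" for R
  have v': "v \<in> borel_measurable borel" "integrable lborel (\<lambda>\<xi>. (cmod (v \<xi>))\<^sup>2)"
    and w': "w \<in> borel_measurable borel" "integrable lborel (\<lambda>\<xi>. (cmod (w \<xi>))\<^sup>2)"
    using v w by (auto simp: is_fourier_L2_def square_integrable_def)
  note cut = cut_off_integrable[OF u u2]
  have F: "F R \<in> borel_measurable borel" "integrable lborel (\<lambda>\<xi>. (cmod (F R \<xi>))\<^sup>2)" for R
    using cut(1)[of R] plancherel_le(1)[OF cut[of R]] by (auto simp: F_def)
  have Fv: "integrable lborel (\<lambda>\<xi>. (cmod (F R \<xi> - v \<xi>))\<^sup>2)" for R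
    using F[of R] v' by (intro integrable_cmod_diff_power2) auto
  have Fw: "integrable lborel (\<lambda>\<xi>. (cmod (F R \<xi> - w \<xi>))\<^sup>2)" for R
    using F[of R] w' by (intro integrable_cmod_diff_power2) auto
  have vw: "integrable lborel (\<lambda>\<xi>. (cmod (v \<xi> - w \<xi>))\<^sup>2)"
    using v' w' by (intro integrable_cmod_diff_power2) auto
  have le: "(LINT \<xi>|lborel. (cmod (v \<xi> - w \<xi>))\<^sup>2)
    \<le> 2 * (LINT \<xi>|lborel. (cmod (F R \<xi> - v \<xi>))\<^sup>2) + 2 * (LINT \<xi>|lborel. (cmod (F R \<xi> - w \<xi>))\<^sup>2)" for R
  proof -
    have "(LINT \<xi>|lborel. (cmod (v \<xi> - w \<xi>))\<^sup>2)
      \<le> (LINT \<xi>|lborel. 2 * (cmod (F R \<xi> - v \<xi>))\<^sup>2 + 2 * (cmod (F R \<xi> - w \<xi>))\<^sup>2)"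
    proof (rule integral_mono)
      show "(cmod (v \<xi> - w \<xi>))\<^sup>2 \<le> 2 * (cmod (F R \<xi> - v \<xi>))\<^sup>2 + 2 * (cmod (F R \<xi> - w \<xi>))\<^sup>2" for \<xi>
        using cmod_add_power2_le[of "v \<xi> - F R \<xi>" "F R \<xi> - w \<xi>"] by (simp add: norm_minus_commute)
    qed (intro vw Bochner_Integration.integrable_add integrable_mult_right Fv Fw)+
    then show ?thesis using Fv[of R] Fw[of R] by simp
  qed
  have "((\<lambda>R. 2 * (LINT \<xi>|lborel. (cmod (F R \<xi> - v \<xi>))\<^sup>2) + 2 * (LINT \<xi>|lborel. (cmod (F R \<xi> - w \<xi>))\<^sup>2))
      \<longlongrightarrow> 2 * 0 + 2 * 0) at_top"
    using v w unfolding F_def by (intro tendsto_intros) (auto simp: is_fourier_L2_def)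
  then have "(LINT \<xi>|lborel. (cmod (v \<xi> - w \<xi>))\<^sup>2) \<le> 2 * 0 + 2 * 0"
    by (rule tendsto_lowerbound) (intro always_eventually allI le, simp)
  then have "(LINT \<xi>|lborel. (cmod (v \<xi> - w \<xi>))\<^sup>2) = 0"
    by (intro antisym Bochner_Integration.integral_nonneg) auto
  then show ?thesis
    by (subst (asm) integral_nonneg_eq_0_iff_AE[OF vw]) auto
qed

text \<open>\<open>SOME\<close> fixes a representative about which nothing is known pointwise.
  Agreement almost everywhere suffices, because \<open>sobolev_norm2\<close> only integrates
  it.\<close>

lemma fourier_L2_AE_eq:
  fixes u :: "real^'n \<Rightarrow> complex"
  assumes u: "integrable lborel u" and u2: "integrable lborel (\<lambda>x. (cmod (u x))\<^sup>2)"
  shows "is_fourier_L2 u (fourier_L2 u)" "AE \<xi> in lborel. fourier_L2 u \<xi> = fourier_L1 u \<xi>"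
proof -
  show *: "is_fourier_L2 u (fourier_L2 u)"
    unfolding fourier_L2_def by (rule someI[of "is_fourier_L2 u"]) (rule is_fourier_L2_fourier_L1[OF u u2])
  show "AE \<xi> in lborel. fourier_L2 u \<xi> = fourier_L1 u \<xi>"
    by (rule is_fourier_L2_unique[OF u u2 * is_fourier_L2_fourier_L1[OF u u2]])
qed

subsection \<open>Translates of the Bessel potential\<close>

text \<open>Replacing \<open>z\<close> by its inverse turns the right limit at 0 into a limit at
  infinity, the form in which dominated convergence is applied.\<close>

lemma tendsto_integral_bessel_kernel:
  assumes \<nu>: "\<nu> > 0"
  shows "((\<lambda>z. LINT t|lborel. bessel_kernel \<nu> z t) \<longlongrightarrow> (LINT t|lborel. bessel_kernel \<nu> 0 t)) (at_right 0)"
  unfolding filterlim_at_right_to_top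
proof (rule integral_dominated_convergence_at_top[OF _ _ integrable_bessel_kernel[OF \<nu>]])
  show "\<forall>\<^sub>F z in at_top. AE t in lborel. norm (bessel_kernel \<nu> (inverse z) t) \<le> bessel_kernel \<nu> 0 t"
    by (simp add: bessel_kernel_nonneg bessel_kernel_le)
  have "((\<lambda>z. bessel_kernel \<nu> (inverse z) t) \<longlongrightarrow> indicator {0<..} t * (t powr (\<nu> - 1) * exp (- t - 0\<^sup>2 / (4 * t)))) at_top" for t
    unfolding bessel_kernel_def
    by (cases "t = 0", simp) (intro tendsto_intros tendsto_inverse_0_at_top filterlim_ident, simp)
  then show "AE t in lborel. ((\<lambda>z. bessel_kernel \<nu> (inverse z) t) \<longlongrightarrow> bessel_kernel \<nu> 0 t) at_top"
    by (simp add: bessel_kernel_def)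
qed measurable

text \<open>The value at 0 is defined by a \<open>Lim\<close>. The integral is continuous there from
  the right, so one formula covers the origin as well.\<close>

lemma bessel_G_eq_integral_bessel_kernel:
  assumes \<gamma>: "\<gamma> > real n / 2" and z: "z \<ge> 0"
  shows "bessel_G n \<gamma> z
    = (LINT t|lborel. bessel_kernel (\<gamma> - real n / 2) z t) / ((4 * pi) powr (real n / 2) * Gamma \<gamma>)"
proof (cases "z > 0")
  case True
  then show ?thesis by (simp add: bessel_G_def bessel_profile_eq_integral_bessel_kernel[OF \<gamma>])
next
  case False
  with z have z: "z = 0" by simp
  let ?c = "(4 * pi) powr (real n / 2) * Gamma \<gamma>"
  have "\<gamma> > 0" using \<gamma> by (rule le_less_trans[rotated]) simp
  then have "?c \<noteq> 0" using Gamma_real_pos[of \<gamma>] by (simp add: less_imp_neq[symmetric])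
  then have "((\<lambda>z. (LINT t|lborel. bessel_kernel (\<gamma> - real n / 2) z t) / ?c)
      \<longlongrightarrow> (LINT t|lborel. bessel_kernel (\<gamma> - real n / 2) 0 t) / ?c) (at_right 0)"
    using \<gamma> by (intro tendsto_divide tendsto_integral_bessel_kernel tendsto_const) auto
  then have "(bessel_profile n \<gamma> \<longlongrightarrow> (LINT t|lborel. bessel_kernel (\<gamma> - real n / 2) 0 t) / ?c) (at_right 0)"
  proof (rule Lim_transform_eventually)
    show "\<forall>\<^sub>F z in at_right 0. (LINT t|lborel. bessel_kernel (\<gamma> - real n / 2) z t) / ?c = bessel_profile n \<gamma> z"
      using eventually_at_right_less[of 0]
      by eventually_elim (simp add: bessel_profile_eq_integral_bessel_kernel[OF \<gamma>])
  qed
  then have "Lim (at_right 0) (bessel_profile n \<gamma>) = (LINT t|lborel. bessel_kernel (\<gamma> - real n / 2) 0 t) / ?c"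
    by (rule tendsto_Lim[OF trivial_limit_at_right_real])
  then show ?thesis by (simp add: z bessel_G_def)
qed

lemma besselG_fourier:
  fixes \<alpha> :: real
  assumes \<alpha>: "\<alpha> > real CARD('n) / 2"
  shows "integrable lborel (\<lambda>x::real^'n. complex_of_real (besselG \<alpha> x))"
    and "fourier_L1 (\<lambda>x::real^'n. complex_of_real (besselG \<alpha> x)) \<xi> = complex_of_real ((1 + (norm \<xi>)\<^sup>2) powr (- \<alpha>))"
proof -
  define h where "h = real CARD('n) / 2"
  define \<nu> where "\<nu> = \<alpha> - h"
  have \<nu>: "\<nu> > 0" and \<alpha>0: "\<alpha> > 0" using \<alpha> by (auto simp: \<nu>_def h_def intro: le_less_trans[rotated])
  have \<Gamma>: "Gamma \<alpha> > 0" using \<alpha>0 by (rule Gamma_real_pos)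
  define \<kappa> where "\<kappa> = (4 * pi) powr h * Gamma \<alpha>"
  have \<kappa>: "\<kappa> > 0" using \<Gamma> by (simp add: \<kappa>_def)
  have G: "besselG \<alpha> x = (LINT t|lborel. bessel_kernel \<nu> (norm x) t) / \<kappa>" for x :: "real^'n"
    using bessel_G_eq_integral_bessel_kernel[OF \<alpha>, of "norm x"] by (simp add: besselG_def \<nu>_def \<kappa>_def h_def)
  \<comment> \<open>Transforming in \<open>x\<close> produces (4 pi t)^(n/2), which raises
    t^(\<nu>-1) to t^(\<alpha>-1), and a factor exp(-t |\<xi>|^2), which merges with
    exp(-t).\<close>
  have kernel_fourier: "has_bochner_integral lborel
      (\<lambda>x::real^'n. cis (- (\<xi> \<bullet> x)) * complex_of_real (bessel_kernel \<nu> (norm x) t))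
      (complex_of_real ((4 * pi) powr h * (indicator {0<..} t * (t powr (\<alpha> - 1) * exp (- ((1 + (norm \<xi>)\<^sup>2) * t))))))" for t \<xi>
  proof (cases "t > 0")
    case True
    have "has_bochner_integral lborel
      (\<lambda>x::real^'n. complex_of_real (t powr (\<nu> - 1) * exp (- t)) * (cis (- (\<xi> \<bullet> x)) * complex_of_real (exp (- (1 / (4 * t)) * (norm x)\<^sup>2))))
      (complex_of_real (t powr (\<nu> - 1) * exp (- t)) * complex_of_real ((pi / (1 / (4 * t))) powr (CARD('n) / 2) * exp (- (norm \<xi>)\<^sup>2 / (4 * (1 / (4 * t))))))"
      using True gaussian_fourier[of "1 / (4 * t)" \<xi>] by (intro has_bochner_integral_mult_right) auto
    also have "(\<lambda>x::real^'n. complex_of_real (t powr (\<nu> - 1) * exp (- t)) * (cis (- (\<xi> \<bullet> x)) * complex_of_real (exp (- (1 / (4 * t)) * (norm x)\<^sup>2))))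
      = (\<lambda>x. cis (- (\<xi> \<bullet> x)) * complex_of_real (bessel_kernel \<nu> (norm x) t))"
    proof
      fix x :: "real^'n"
      have "bessel_kernel \<nu> (norm x) t = t powr (\<nu> - 1) * exp (- t) * exp (- (1 / (4 * t)) * (norm x)\<^sup>2)"
        using True by (simp add: bessel_kernel_def mult.assoc flip: exp_add)
      then show "complex_of_real (t powr (\<nu> - 1) * exp (- t)) * (cis (- (\<xi> \<bullet> x)) * complex_of_real (exp (- (1 / (4 * t)) * (norm x)\<^sup>2)))
        = cis (- (\<xi> \<bullet> x)) * complex_of_real (bessel_kernel \<nu> (norm x) t)"
        by (simp only: of_real_mult mult_ac)
    qed
    also have "complex_of_real (t powr (\<nu> - 1) * exp (- t)) * complex_of_real ((pi / (1 / (4 * t))) powr (CARD('n) / 2) * exp (- (norm \<xi>)\<^sup>2 / (4 * (1 / (4 * t)))))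
      = complex_of_real ((4 * pi) powr h * (indicator {0<..} t * (t powr (\<alpha> - 1) * exp (- ((1 + (norm \<xi>)\<^sup>2) * t)))))"
    proof -
      have "(pi / (1 / (4 * t))) powr (CARD('n) / 2) = (4 * pi) powr h * t powr h"
        using True by (simp add: h_def mult_ac flip: powr_mult)
      moreover have "t powr (\<nu> - 1) * t powr h = t powr (\<alpha> - 1)"
        using True by (simp add: \<nu>_def flip: powr_add)
      moreover have "exp (- t) * exp (- (norm \<xi>)\<^sup>2 / (4 * (1 / (4 * t)))) = exp (- ((1 + (norm \<xi>)\<^sup>2) * t))"
        using True by (simp add: algebra_simps flip: exp_add)
      moreover have "a * b * (c * d * e) = c * (a * d * (b * e))" for a b c d e :: real
        by simp
      ultimately have "t powr (\<nu> - 1) * exp (- t) * ((pi / (1 / (4 * t))) powr (CARD('n) / 2) * exp (- (norm \<xi>)\<^sup>2 / (4 * (1 / (4 * t)))))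
        = (4 * pi) powr h * (t powr (\<alpha> - 1) * exp (- ((1 + (norm \<xi>)\<^sup>2) * t)))"
        by (simp only:)
      then show ?thesis using True by (simp flip: of_real_mult)
    qed
    finally show ?thesis .
  qed (simp add: bessel_kernel_def has_bochner_integral_zero)
  \<comment> \<open>The kernel is nonnegative, so its transform at frequency 0 is its L1 norm in
    \<open>x\<close>. This is the input for absolute integrability on the product space.\<close>
  have kernel_mass: "has_bochner_integral lborel (\<lambda>x::real^'n. bessel_kernel \<nu> (norm x) t)
     ((4 * pi) powr h * (indicator {0<..} t * (t powr (\<alpha> - 1) * exp (- (1 * t)))))" for t
    using has_bochner_integral_Re[OF kernel_fourier[of 0 t]] by simp
  have prod: "integrable (lborel \<Otimes>\<^sub>M lborel) (\<lambda>(t, x). cis (- (\<xi> \<bullet> x)) * complex_of_real (bessel_kernel \<nu> (norm x) t))" for \<xi> :: "real^'n"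
  proof (rule lborel_pair.Fubini_integrable)
    show "(\<lambda>(t, x). cis (- (\<xi> \<bullet> x)) * complex_of_real (bessel_kernel \<nu> (norm x) t)) \<in> borel_measurable (lborel \<Otimes>\<^sub>M lborel)"
      unfolding cis_conv_exp by measurable
    have "(LINT x::real^'n|lborel. bessel_kernel \<nu> (norm x) t)
        = (4 * pi) powr h * (indicator {0<..} t * (t powr (\<alpha> - 1) * exp (- (1 * t))))" for t
      using kernel_mass[of t] by (simp add: has_bochner_integral_iff)
    moreover have "integrable lborel (\<lambda>t. (4 * pi) powr h * (indicator {0<..} t * (t powr (\<alpha> - 1) * exp (- (1 * t)))))"
      using has_bochner_integral_Gamma_scaled[OF \<alpha>0, of 1]
      by (intro integrable_mult_right) (auto simp: has_bochner_integral_iff)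
    ultimately show "integrable lborel (\<lambda>t. LINT x|lborel. norm (case (t, x) of (t, x) \<Rightarrow> cis (- (\<xi> \<bullet> x)) * complex_of_real (bessel_kernel \<nu> (norm x) t)))"
      by (simp add: norm_mult bessel_kernel_nonneg)
    show "AE t in lborel. integrable lborel (\<lambda>x. case (t, x) of (t, x) \<Rightarrow> cis (- (\<xi> \<bullet> x)) * complex_of_real (bessel_kernel \<nu> (norm x) t))"
      using kernel_fourier by (simp add: has_bochner_integral_iff)
  qed
  have inner: "(LINT t|lborel. cis (- (\<xi> \<bullet> x)) * complex_of_real (bessel_kernel \<nu> (norm x) t))
      = \<kappa> * (cis (- (\<xi> \<bullet> x)) * complex_of_real (besselG \<alpha> x))" for \<xi> x :: "real^'n"
    using \<kappa> by (simp add: G)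
  \<comment> \<open>At frequency 0 the phase is 1, so the partial integral over \<open>t\<close> is
    \<kappa> times \<open>besselG\<close> itself.\<close>
  have "integrable lborel (\<lambda>x::real^'n. \<kappa> * (cis (- (0 \<bullet> x)) * complex_of_real (besselG \<alpha> x)))"
    using lborel_pair.integrable_snd[OF prod[of 0]] unfolding inner .
  then have "integrable lborel (\<lambda>x::real^'n. (\<kappa> * (cis (- (0 \<bullet> x)) * complex_of_real (besselG \<alpha> x))) / \<kappa>)"
    by (rule integrable_divide_zero)
  then show "integrable lborel (\<lambda>x::real^'n. complex_of_real (besselG \<alpha> x))"
    using \<kappa> by simp
  have "\<kappa> * fourier_L1 (\<lambda>x. complex_of_real (besselG \<alpha> x)) \<xi>
     = (LINT x|lborel. (LINT t|lborel. cis (- (\<xi> \<bullet> x)) * complex_of_real (bessel_kernel \<nu> (norm x) t)))"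
    unfolding inner fourier_L1_def by simp
  also have "\<dots> = (LINT t|lborel. (LINT x|lborel. cis (- (\<xi> \<bullet> x)) * complex_of_real (bessel_kernel \<nu> (norm x) t)))"
    by (rule lborel_pair.Fubini_integral[OF prod])
  also have "\<dots> = (LINT t|lborel. complex_of_real ((4 * pi) powr h * (indicator {0<..} t * (t powr (\<alpha> - 1) * exp (- ((1 + (norm \<xi>)\<^sup>2) * t))))))"
    using kernel_fourier[of \<xi>] by (simp only: has_bochner_integral_iff)
  also have "\<dots> = complex_of_real ((4 * pi) powr h * (Gamma \<alpha> / (1 + (norm \<xi>)\<^sup>2) powr \<alpha>))"
  proof -
    have "1 + (norm \<xi>)\<^sup>2 > 0" by (simp add: add_pos_nonneg)
    from has_bochner_integral_Gamma_scaled[OF \<alpha>0 this] show ?thesis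
      unfolding integral_complex_of_real integral_mult_right_zero by (simp only: has_bochner_integral_iff)
  qed
  also have "\<dots> = \<kappa> * complex_of_real ((1 + (norm \<xi>)\<^sup>2) powr (- \<alpha>))"
    by (simp add: \<kappa>_def powr_minus_divide)
  finally show "fourier_L1 (\<lambda>x::real^'n. complex_of_real (besselG \<alpha> x)) \<xi> = complex_of_real ((1 + (norm \<xi>)\<^sup>2) powr (- \<alpha>))"
    using \<kappa> by simp
qed

text \<open>Boundedness together with integrability gives square integrability of finite
  combinations of translates, via |u|^2 \<le> sup|u| |u|.\<close>

lemma besselG_bounded:
  fixes \<alpha> :: real
  assumes \<alpha>: "\<alpha> > real CARD('n) / 2"
  obtains C where "\<And>x::real^'n. \<bar>besselG \<alpha> x\<bar> \<le> C"
proof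
  fix x :: "real^'n"
  define \<nu> where "\<nu> = \<alpha> - real CARD('n) / 2"
  have \<nu>: "\<nu> > 0" using \<alpha> by (simp add: \<nu>_def)
  have \<kappa>: "(4 * pi) powr (real CARD('n) / 2) * Gamma \<alpha> > 0"
    using \<alpha> by (intro mult_pos_pos Gamma_real_pos) (auto intro: le_less_trans[rotated])
  have "0 \<le> (LINT t|lborel. bessel_kernel \<nu> (norm x) t)"
    by (simp add: bessel_kernel_nonneg)
  moreover have "(LINT t|lborel. bessel_kernel \<nu> (norm x) t) \<le> (LINT t|lborel. bessel_kernel \<nu> 0 t)"
    by (intro integral_mono integrable_bessel_kernel \<nu> bessel_kernel_le)
  ultimately show "\<bar>besselG \<alpha> x\<bar> \<le> (LINT t|lborel. bessel_kernel \<nu> 0 t) / ((4 * pi) powr (real CARD('n) / 2) * Gamma \<alpha>)"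
    using bessel_G_eq_integral_bessel_kernel[OF \<alpha>, of "norm x"] \<kappa>
    by (simp add: besselG_def \<nu>_def abs_divide divide_right_mono abs_of_pos)
qed

lemma besselG_sum_fourier:
  fixes X :: "'i \<Rightarrow> real^'n" and c :: "'i \<Rightarrow> complex"
  assumes \<alpha>: "\<alpha> > real CARD('n) / 2"
  defines "u \<equiv> \<lambda>S x. \<Sum>j\<in>S. c j * complex_of_real (besselG \<alpha> (x - X j))"
  shows "integrable lborel (u S)" "integrable lborel (\<lambda>x. (cmod (u S x))\<^sup>2)"
    and "fourier_L1 (u S) \<xi> = trig_sum S c X \<xi> * complex_of_real ((1 + (norm \<xi>)\<^sup>2) powr (- \<alpha>))"
proof -
  note G = besselG_fourier[OF \<alpha>]
  have int: "integrable lborel (\<lambda>x. complex_of_real (besselG \<alpha> (x - X j)))" for j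
    using integral_translate[OF G(1), of "X j"] by (simp add: has_bochner_integral_iff)
  show u: "integrable lborel (u S)"
    unfolding u_def by (intro Bochner_Integration.integrable_sum integrable_mult_right int)
  obtain C where C: "\<And>x::real^'n. \<bar>besselG \<alpha> x\<bar> \<le> C"
    using besselG_bounded[OF \<alpha>] by blast
  have u_le: "cmod (u S x) \<le> (\<Sum>j\<in>S. cmod (c j) * C)" for x
    unfolding u_def by (rule order_trans[OF norm_sum]) (auto simp: norm_mult intro!: sum_mono mult_left_mono C)
  show "integrable lborel (\<lambda>x. (cmod (u S x))\<^sup>2)"
  proof (rule Bochner_Integration.integrable_bound)
    show "integrable lborel (\<lambda>x. (\<Sum>j\<in>S. cmod (c j) * C) * cmod (u S x))"
      using u by simp
    show "(\<lambda>x. (cmod (u S x))\<^sup>2) \<in> borel_measurable lborel"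
      using borel_measurable_integrable[OF u] by measurable
    show "AE x in lborel. norm ((cmod (u S x))\<^sup>2) \<le> norm ((\<Sum>j\<in>S. cmod (c j) * C) * cmod (u S x))"
    proof (rule AE_I2)
      fix x
      have "(cmod (u S x))\<^sup>2 \<le> (\<Sum>j\<in>S. cmod (c j) * C) * cmod (u S x)"
        using mult_right_mono[OF u_le[of x], of "cmod (u S x)"] by (simp add: power2_eq_square)
      also have "\<dots> \<le> \<bar>(\<Sum>j\<in>S. cmod (c j) * C) * cmod (u S x)\<bar>" by simp
      finally show "norm ((cmod (u S x))\<^sup>2) \<le> norm ((\<Sum>j\<in>S. cmod (c j) * C) * cmod (u S x))" by simp
    qed
  qed
  show "fourier_L1 (u S) \<xi> = trig_sum S c X \<xi> * complex_of_real ((1 + (norm \<xi>)\<^sup>2) powr (- \<alpha>))"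
    unfolding u_def
    by (subst fourier_L1_sum[OF int])
       (simp add: trig_sum_def sum_distrib_right mult.assoc
         fourier_L1_translate[OF G(1)] G(2))
qed

section \<open>Riesz bounds in the Sobolev norm\<close>

lemma separation_le:
  assumes "j \<noteq> k"
  shows "separation X \<le> dist (X j) (X k)"
  unfolding separation_def
proof (rule cInf_lower)
  show "dist (X j) (X k) \<in> {dist (X j) (X k) |j k. j \<noteq> k}" using assms by blast
  show "bdd_below {dist (X j) (X k) |j k. j \<noteq> k}" by (rule bdd_belowI[of _ 0]) auto
qed

theorem riesz_sequence_besselG:
  fixes \<alpha> :: real and X :: "nat \<Rightarrow> real^'n"
  assumes \<alpha>: "\<alpha> > real CARD('n) / 2" and sep: "separation X > 0"
  shows "riesz_sequence_sobolev \<alpha> (\<lambda>j x. complex_of_real (besselG \<alpha> (x - X j)))"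
proof -
  have \<alpha>': "\<alpha> > real DIM(real^'n) / 2" using \<alpha> by simp
  define w where "w \<xi> = (1 + (norm \<xi>)\<^sup>2) powr (- \<alpha>)" for \<xi> :: "real^'n"
  obtain A B where A: "0 < A"
    and int: "\<And>S c. finite S \<Longrightarrow> integrable lborel (\<lambda>\<xi>. (cmod (trig_sum S c X \<xi>))\<^sup>2 * w \<xi>)"
    and lower: "\<And>S c. finite S \<Longrightarrow> A * (\<Sum>j\<in>S. (cmod (c j))\<^sup>2) \<le> (LINT \<xi>|lborel. (cmod (trig_sum S c X \<xi>))\<^sup>2 * w \<xi>)"
    and upper: "\<And>S c. finite S \<Longrightarrow> (LINT \<xi>|lborel. (cmod (trig_sum S c X \<xi>))\<^sup>2 * w \<xi>) \<le> B * (\<Sum>j\<in>S. (cmod (c j))\<^sup>2)"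
    unfolding w_def
    by (rule trig_sum_weight_bounds[of \<alpha> "separation X" X]) (use \<alpha>' sep separation_le[of _ _ X] in blast)+
  define u where "u c S x = (\<Sum>j\<in>S. c j * complex_of_real (besselG \<alpha> (x - X j)))" for c and S :: "nat set" and x
  have u: "integrable lborel (u c S)" "integrable lborel (\<lambda>x. (cmod (u c S x))\<^sup>2)"
    and fourier_u: "fourier_L1 (u c S) \<xi> = trig_sum S c X \<xi> * complex_of_real (w \<xi>)" for c S \<xi>
    unfolding u_def w_def by (rule besselG_sum_fourier[OF \<alpha>])+
  \<comment> \<open>The Sobolev weight is 1/w and the squared transform contributes w^2, so a single
    factor \<open>w\<close> remains, the weight of \<open>trig_sum_weight_bounds\<close>.\<close>
  have weight: "(1 + (norm \<xi>)\<^sup>2) powr \<alpha> * (cmod (fourier_L1 (u c S) \<xi>))\<^sup>2 = (cmod (trig_sum S c X \<xi>))\<^sup>2 * w \<xi>" for c S \<xi>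
  proof -
    have "1 + (norm \<xi>)\<^sup>2 > 0" by (simp add: add_pos_nonneg)
    then have "(1 + (norm \<xi>)\<^sup>2) powr \<alpha> * w \<xi> = 1"
      by (simp add: w_def flip: powr_add)
    moreover have "(cmod (fourier_L1 (u c S) \<xi>))\<^sup>2 = (cmod (trig_sum S c X \<xi>))\<^sup>2 * w \<xi> * w \<xi>"
      by (simp add: fourier_u norm_mult power_mult_distrib power2_eq_square)
    moreover have "a * (b * c * c) = b * c * (a * c)" for a b c :: real
      by simp
    ultimately show ?thesis by (simp only: mult_1_right)
  qed
  have norm: "sobolev_norm2 \<alpha> (u c S) = (2 * pi) powr (- real CARD('n)) * (LINT \<xi>|lborel. (cmod (trig_sum S c X \<xi>))\<^sup>2 * w \<xi>)" for c S
  proof -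
    note L2 = fourier_L2_AE_eq[OF u[of c S]]
    have [measurable]: "fourier_L2 (u c S) \<in> borel_measurable borel"
      using L2(1) by (simp add: is_fourier_L2_def square_integrable_def)
    have "(LINT \<xi>|lborel. (1 + (norm \<xi>)\<^sup>2) powr \<alpha> * (cmod (fourier_L2 (u c S) \<xi>))\<^sup>2)
      = (LINT \<xi>|lborel. (cmod (trig_sum S c X \<xi>))\<^sup>2 * w \<xi>)"
    proof (rule integral_cong_AE)
      show "AE \<xi> in lborel. (1 + (norm \<xi>)\<^sup>2) powr \<alpha> * (cmod (fourier_L2 (u c S) \<xi>))\<^sup>2 = (cmod (trig_sum S c X \<xi>))\<^sup>2 * w \<xi>"
        using L2(2) by eventually_elim (simp only: weight)
      show "(\<lambda>\<xi>. (cmod (trig_sum S c X \<xi>))\<^sup>2 * w \<xi>) \<in> borel_measurable lborel"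
        unfolding w_def by measurable
    qed measurable
    then show ?thesis by (simp add: sobolev_norm2_def)
  qed
  have "(\<lambda>x. complex_of_real (besselG \<alpha> (x - X j))) \<in> sobolev \<alpha>" for j
  proof -
    \<comment> \<open>A single translate is the combination over \<open>{j}\<close> with coefficient
      1, so membership is an instance of the facts about \<open>u\<close>.\<close>
    have "u (\<lambda>_. 1) {j} \<in> sobolev \<alpha>"
      unfolding sobolev_def
    proof (intro CollectI conjI exI)
      show "square_integrable (u (\<lambda>_. 1) {j})"
        using u[of "\<lambda>_. 1" "{j}"] by (simp add: square_integrable_def borel_measurable_integrable)
      show "is_fourier_L2 (u (\<lambda>_. 1) {j}) (fourier_L1 (u (\<lambda>_. 1) {j}))"
        by (rule is_fourier_L2_fourier_L1[OF u])
      show "integrable lborel (\<lambda>\<xi>. (1 + (norm \<xi>)\<^sup>2) powr \<alpha> * (cmod (fourier_L1 (u (\<lambda>_. 1) {j}) \<xi>))\<^sup>2)"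
        unfolding weight by (rule int) simp
    qed
    then show ?thesis by (simp add: u_def[abs_def])
  qed
  moreover define N where "N = (2 * pi) powr (- real CARD('n))"
  have N: "N > 0" by (simp add: N_def)
  \<comment> \<open>The two bounds are obtained without a comparison of \<open>A\<close> and
    \<open>B\<close>; the maximum enforces the required order of the constants.\<close>
  have "0 < N * A \<and> N * A \<le> max (N * A) (N * B) \<and>
        (\<forall>(S::nat set) (c::nat \<Rightarrow> complex). finite S \<longrightarrow>
            N * A * (\<Sum>j\<in>S. (cmod (c j))\<^sup>2) \<le> sobolev_norm2 \<alpha> (\<lambda>x. \<Sum>j\<in>S. c j * complex_of_real (besselG \<alpha> (x - X j))) \<and>
            sobolev_norm2 \<alpha> (\<lambda>x. \<Sum>j\<in>S. c j * complex_of_real (besselG \<alpha> (x - X j))) \<le> max (N * A) (N * B) * (\<Sum>j\<in>S. (cmod (c j))\<^sup>2))"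
  proof (intro conjI allI impI)
    fix S :: "nat set" and c :: "nat \<Rightarrow> complex"
    assume S: "finite S"
    have norm': "sobolev_norm2 \<alpha> (\<lambda>x. \<Sum>j\<in>S. c j * complex_of_real (besselG \<alpha> (x - X j)))
       = N * (LINT \<xi>|lborel. (cmod (trig_sum S c X \<xi>))\<^sup>2 * w \<xi>)"
      using norm[of c S] by (simp add: u_def[abs_def] N_def)
    show "N * A * (\<Sum>j\<in>S. (cmod (c j))\<^sup>2) \<le> sobolev_norm2 \<alpha> (\<lambda>x. \<Sum>j\<in>S. c j * complex_of_real (besselG \<alpha> (x - X j)))"
      unfolding norm' mult.assoc using lower[OF S, of c] N by (intro mult_left_mono) auto
    have "sobolev_norm2 \<alpha> (\<lambda>x. \<Sum>j\<in>S. c j * complex_of_real (besselG \<alpha> (x - X j))) \<le> N * B * (\<Sum>j\<in>S. (cmod (c j))\<^sup>2)"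
      unfolding norm' mult.assoc using upper[OF S, of c] N by (intro mult_left_mono) auto
    also have "\<dots> \<le> max (N * A) (N * B) * (\<Sum>j\<in>S. (cmod (c j))\<^sup>2)"
      by (intro mult_right_mono sum_nonneg) auto
    finally show "sobolev_norm2 \<alpha> (\<lambda>x. \<Sum>j\<in>S. c j * complex_of_real (besselG \<alpha> (x - X j))) \<le> max (N * A) (N * B) * (\<Sum>j\<in>S. (cmod (c j))\<^sup>2)" .
  qed (use A N in auto)
  ultimately show ?thesis unfolding riesz_sequence_sobolev_def by blast
qed

theorem theorem6p4:
  fixes \<alpha> :: real and X :: "nat \<Rightarrow> real^'n"
  assumes "\<alpha> > real CARD('n) / 2"
    and "inj X"
    and "separation X > 0"
  shows "(CARD('n) \<ge> 2 \<longrightarrow>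
            riesz_sequence_sobolev \<alpha> (\<lambda>j x. complex_of_real (besselG \<alpha> (x - X j))))
       \<and> (CARD('n) = 1 \<and> separation X > 4 * Gamma \<alpha> * Gamma (1/2) / Gamma (\<alpha> - 1/2) \<longrightarrow>
            riesz_sequence_sobolev \<alpha> (\<lambda>j x. complex_of_real (besselG \<alpha> (x - X j))))"
  using riesz_sequence_besselG[OF assms(1,3)] by blast

end
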